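(* The port-Hamiltonian system with boundary dissipation described in the context is exponentially stable; that is, there exist constants $M\ge 1$ and $\alpha>0$ such that $H(t)\le Me^{-\alpha t}H(0)$ for all $t\ge 0$ along solutions, where $H(t)=\frac12\int_a^b z^\top(x,t)Q(x)z(x,t)\,dx$ is the energy. Furthermore, for $\xi\in(0,1)$, the decay rate is at least $$\alpha=\begin{cases}\dfrac{\xi}{\xi+1}\,\dfrac{\eta_Q^2\,e^{-\left(1+\frac{\mu_B}{\eta_Q}(b-a)\right)}}{(b-a)\,\mu_Q\,\mu_{P_1}} & \text{if } \varepsilon_0\le\varepsilon_1,\\[3ex] \dfrac{2\xi\,\eta_K\,\eta_Q^2\,e^{-\left(1+\frac{\mu_B}{\eta_Q}(b-a)\right)}}{(b-a)\,\mu_Q\left(\mu_{P_1}\eta_K+2\xi\,\eta_Q\mu_\Psi\right)} & \text{otherwise.}\end{cases}$$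
   Context: Let $a<b$ be real and $n$ an even positive integer. Let $P_1=P_1^\top\in\mathbb{R}^{n\times n}$ be invertible, $P_0=-P_0^\top\in\mathbb{R}^{n\times n}$, $G_0=G_0^\top\ge 0$ in $\mathbb{R}^{n\times n}$, and let $Q\in H^1([a,b],\mathbb{R}^{n\times n})$ satisfy $Q(x)=Q(x)^\top>0$ (positive definite) for all $x\in[a,b]$. Let $W_1,\tilde W_1,W_2$ be real $\frac n2\times n$ matrices such that $\begin{bmatrix}0&W_2\\ W_1&0\end{bmatrix}$ has rank $n$ and $\begin{bmatrix}W_1\\ \tilde W_1\end{bmatrix}$ has rank $n$, and such that for some $\tilde W_2\in\mathbb{R}^{\frac n2\times n}$ $$W_1^\top\tilde W_1+\tilde W_1^\top W_1=P_1=-(W_2^\top\tilde W_2+\tilde W_2^\top W_2).$$ Let $K=K^\top>0$ in $\mathbb{R}^{\frac n2\times\frac n2}$. The system for the state $z(x,t)\in\mathbb{R}^n$, $x\in[a,b]$, $t\ge0$, with $z(\cdot,t)\in L^2([a,b],\mathbb{R}^n)$, is $$\frac{\partial z}{\partial t}(x,t)=P_1\frac{\partial}{\partial x}\big(Q(x)z(x,t)\big)+(P_0-G_0)Q(x)z(x,t),$$ with boundary conditions $$W_2Q(a)z(a,t)=0,\qquad u_b(t)+Ky_b(t)=0,$$ where $u_b(t)=W_1Q(b)z(b,t)$ and $y_b(t)=\tilde W_1Q(b)z(b,t)$. This system is well-posed. Matrices: $$\Psi(x)=\begin{bmatrix}-K\\ I\end{bmatrix}^\top\begin{bmatrix}W_1\\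 \tilde W_1\end{bmatrix}^{-\top}Q^{-1}(x)\begin{bmatrix}W_1\\ \tilde W_1\end{bmatrix}^{-1}\begin{bmatrix}-K\\ I\end{bmatrix},$$ $$B(x)=\frac{dQ}{dx}(x)-Q(x)(P_0+G_0)P_1^{-1}+P_1^{-1}(P_0-G_0)Q(x).$$ Constants ($\mathrm{eig}$ denotes the set of eigenvalues): $\mu_Q=\max_{x\in[a,b]}\max\mathrm{eig}(Q(x))$, $\eta_Q=\min_{x\in[a,b]}\min\mathrm{eig}(Q(x))$, $\mu_B=\max_{x\in[a,b]}\max\mathrm{eig}(B(x))$, $\mu_\Psi=\max_{x\in[a,b]}\max\mathrm{eig}(\Psi(x))$, $\mu_{P_1}=\sqrt{\max\mathrm{eig}(P_1^{-2})}$, $\eta_K=\min\mathrm{eig}(K)$. Moreover $\varepsilon_0=\dfrac{\eta_Q}{\mu_m\mu_{P_1}}$ and $\varepsilon_1=\dfrac{2\eta_K}{\mu_m\mu_\Psi}$, where $\mu_m=\max_{x\in[a,b]}m(x)$ for the multiplier $m(x)=Ce^{\beta(x-a)}$ with $C>0$ and $\beta=\frac1{b-a}+\frac{\mu_B}{\eta_Q}$. The parameter $\xi$ comes from the choice $\varepsilon=\xi\min\{\varepsilon_0,\varepsilon_1\}$ in the Lyapunov functional $H(t)+\frac{\varepsilon}{2}\int_a^b m(x)z^\top(x,t)P_1^{-1}z(x,t)\,dx$.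
   Formalization: The explicit decay rate is proved under two added assumptions: the largest eigenvalue of B(x) is bounded above on [a,b] (so that μ_B exists), and β = 1/(b−a) + μ_B/η_Q ≥ 0; for β < 0 the stated rate can fail. Exponential stability itself needs neither. *)

theory Defs
  imports "HOL-Analysis.Analysis"
begin

section \<open>Matrices\<close>

text \<open>Block matrices are indexed by sum types. A stacked matrix \<open>[A; B]\<close> with \<open>2 CARD('k) = CARD('n)\<close>
  is square although its row type \<open>'k + 'k\<close> and column type \<open>'n\<close> differ; \<^const>\<open>matrix_inv\<close> and
  \<^const>\<open>invertible\<close> are two-sided and accept such matrices.\<close>

definition stack :: "real^'n^'k \<Rightarrow> real^'n^'l \<Rightarrow> real^'n^('k + 'l)" where
  "stack A B = (\<chi> i. case i of Inl j \<Rightarrow> A $ j | Inr j \<Rightarrow> B $ j)"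

definition beside :: "real^'n^'k \<Rightarrow> real^'m^'k \<Rightarrow> real^('n + 'm)^'k" where
  "beside A B = (\<chi> i j. case j of Inl l \<Rightarrow> A $ i $ l | Inr l \<Rightarrow> B $ i $ l)"

definition sym_mat :: "real^'n^'n \<Rightarrow> bool" where
  "sym_mat A \<longleftrightarrow> transpose A = A"

definition skew_mat :: "real^'n^'n \<Rightarrow> bool" where
  "skew_mat A \<longleftrightarrow> transpose A = - A"

definition pos_def :: "real^'n^'n \<Rightarrow> bool" where
  "pos_def A \<longleftrightarrow> sym_mat A \<and> (\<forall>v. v \<noteq> 0 \<longrightarrow> v \<bullet> (A *v v) > 0)"

definition pos_semidef :: "real^'n^'n \<Rightarrow> bool" where
  "pos_semidef A \<longleftrightarrow> sym_mat A \<and> (\<forall>v. v \<bullet> (A *v v) \<ge> 0)"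

text \<open>Real eigenvalues; these are all eigenvalues for the symmetric matrices considered here.\<close>

definition eig :: "real^'n^'n \<Rightarrow> real set" where
  "eig A = {l. \<exists>v. v \<noteq> 0 \<and> A *v v = l *\<^sub>R v}"

definition max_eig :: "real^'n^'n \<Rightarrow> real" where
  "max_eig A = Max (eig A)"

definition min_eig :: "real^'n^'n \<Rightarrow> real" where
  "min_eig A = Min (eig A)"


section \<open>Square-integrable and $H^1$ functions on an interval\<close>

text \<open>Elements of $L^2$ are represented by functions, of which only the values almost everywhere on
  \<open>{a..b}\<close> matter.\<close>

definition L2_fun :: "real \<Rightarrow> real \<Rightarrow> (real \<Rightarrow> 'v::euclidean_space) \<Rightarrow> bool" where
  "L2_fun a b f \<longleftrightarrow>
     f \<in> borel_measurable (lebesgue_on {a..b}) \<and>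
     integrable (lebesgue_on {a..b}) (\<lambda>x. (norm (f x))\<^sup>2)"

definition L2_norm :: "real \<Rightarrow> real \<Rightarrow> (real \<Rightarrow> 'v::euclidean_space) \<Rightarrow> real" where
  "L2_norm a b f = sqrt (LINT x|lebesgue_on {a..b}. (norm (f x))\<^sup>2)"

text \<open>\<open>w\<close> is the continuous representative of an $H^1$ function with weak derivative \<open>w'\<close>, so that
  boundary values are values of \<open>w\<close>. The function \<open>w'\<close> is determined only almost everywhere.\<close>

definition H1_deriv ::
  "real \<Rightarrow> real \<Rightarrow> (real \<Rightarrow> 'v::euclidean_space) \<Rightarrow> (real \<Rightarrow> 'v) \<Rightarrow> bool" where
  "H1_deriv a b w w' \<longleftrightarrow>
     L2_fun a b w' \<and> (\<forall>x\<in>{a..b}. w x = w a + (LINT s|lebesgue_on {a..x}. w' s))"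


section \<open>The port-Hamiltonian system\<close>

text \<open>Graph of the system operator: \<open>z\<close> lies in its domain and is mapped to \<open>f\<close>. Here \<open>e\<close> is the
  $H^1$ representative of \<open>Q z\<close>, and the domain includes the boundary conditions
  \<open>W2 e(a) = 0\<close> and \<open>u + K y = 0\<close>, where \<open>u = W1 e(b)\<close> and \<open>y = W1t e(b)\<close>.\<close>

definition phs_operator ::
  "real \<Rightarrow> real \<Rightarrow> real^'n^'n \<Rightarrow> real^'n^'n \<Rightarrow> real^'n^'n \<Rightarrow> (real \<Rightarrow> real^'n^'n) \<Rightarrow>
   real^'n^'k \<Rightarrow> real^'n^'k \<Rightarrow> real^'n^'k \<Rightarrow> real^'k^'k \<Rightarrow>
   (real \<Rightarrow> real^'n) \<Rightarrow> (real \<Rightarrow> real^'n) \<Rightarrow> bool" where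
  "phs_operator a b P1 P0 G0 Q W1 W1t W2 K z f \<longleftrightarrow>
     L2_fun a b z \<and> L2_fun a b f \<and>
     (\<exists>e e'. H1_deriv a b e e' \<and>
        (AE x in lebesgue_on {a..b}. e x = Q x *v z x) \<and>
        W2 *v e a = 0 \<and>
        W1 *v e b + K *v (W1t *v e b) = 0 \<and>
        (AE x in lebesgue_on {a..b}. f x = P1 *v e' x + (P0 - G0) *v e x))"

text \<open>Mild solutions of \<open>dz/dt = A z\<close> in $L^2$, for an operator given by its graph \<open>A\<close>: \<open>z\<close> is
  continuous in time with values in $L^2$, and for all \<open>t \<ge> 0\<close> the integral \<open>\<integral>\<^sub>0\<^sup>t z(s) ds\<close> lies in the
  domain of \<open>A\<close> and \<open>z(t) = z(0) + A (\<integral>\<^sub>0\<^sup>t z(s) ds)\<close>. The $L^2$-valued integral is expressed as the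
  primitive \<open>Z\<close> of \<open>z\<close> with respect to the $L^2$ norm that vanishes at time 0.
  The state at time \<open>t\<close> and position \<open>x\<close> is \<open>z t x\<close>.\<close>

definition mild_solution ::
  "real \<Rightarrow> real \<Rightarrow> ((real \<Rightarrow> 'v::euclidean_space) \<Rightarrow> (real \<Rightarrow> 'v) \<Rightarrow> bool) \<Rightarrow>
   (real \<Rightarrow> real \<Rightarrow> 'v) \<Rightarrow> bool" where
  "mild_solution a b A z \<longleftrightarrow>
     (\<forall>t\<ge>0. L2_fun a b (z t) \<and>
        ((\<lambda>s. L2_norm a b (\<lambda>x. z s x - z t x)) \<longlongrightarrow> 0) (at t within {0..})) \<and>
     (\<exists>Z. (AE x in lebesgue_on {a..b}. Z 0 x = 0) \<and>
        (\<forall>t\<ge>0. L2_fun a b (Z t) \<and>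
           ((\<lambda>s. L2_norm a b (\<lambda>x. (Z s x - Z t x) /\<^sub>R (s - t) - z t x)) \<longlongrightarrow> 0)
             (at t within {0..}) \<and>
           A (Z t) (\<lambda>x. z t x - z 0 x)))"

definition energy ::
  "real \<Rightarrow> real \<Rightarrow> (real \<Rightarrow> real^'n^'n) \<Rightarrow> (real \<Rightarrow> real^'n) \<Rightarrow> real" where
  "energy a b Q z = 1/2 * (LINT x|lebesgue_on {a..b}. z x \<bullet> (Q x *v z x))"

text \<open>The constant \<open>M\<close> is uniform over all solutions.\<close>

definition energy_decays_at_rate ::
  "real \<Rightarrow> real \<Rightarrow> real^'n^'n \<Rightarrow> real^'n^'n \<Rightarrow> real^'n^'n \<Rightarrow> (real \<Rightarrow> real^'n^'n) \<Rightarrow>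
   real^'n^'k \<Rightarrow> real^'n^'k \<Rightarrow> real^'n^'k \<Rightarrow> real^'k^'k \<Rightarrow> real \<Rightarrow> bool" where
  "energy_decays_at_rate a b P1 P0 G0 Q W1 W1t W2 K \<alpha> \<longleftrightarrow>
     (\<exists>M\<ge>1. \<forall>z. mild_solution a b (phs_operator a b P1 P0 G0 Q W1 W1t W2 K) z \<longrightarrow>
        (\<forall>t\<ge>0. energy a b Q (z t) \<le> M * exp (- \<alpha> * t) * energy a b Q (z 0)))"

definition Psi_mat ::
  "real^'n^'k \<Rightarrow> real^'n^'k \<Rightarrow> real^'k^'k \<Rightarrow> (real \<Rightarrow> real^'n^'n) \<Rightarrow> real \<Rightarrow> real^'k^'k" where
  "Psi_mat W1 W1t K Q x =
     transpose (stack (- K) (mat 1)) ** transpose (matrix_inv (stack W1 W1t)) **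
     matrix_inv (Q x) ** matrix_inv (stack W1 W1t) ** stack (- K) (mat 1)"

definition B_mat ::
  "real^'n^'n \<Rightarrow> real^'n^'n \<Rightarrow> real^'n^'n \<Rightarrow> (real \<Rightarrow> real^'n^'n) \<Rightarrow> (real \<Rightarrow> real^'n^'n) \<Rightarrow>
   real \<Rightarrow> real^'n^'n" where
  "B_mat P1 P0 G0 Q Q' x =
     Q' x - Q x ** (P0 + G0) ** matrix_inv P1 + matrix_inv P1 ** (P0 - G0) ** Q x"

end

theory Submission
  imports Defs
begin

text \<open>Along the difference quotients of the primitive of a mild solution the Lyapunov functional
  \<open>V z = 1/2 \<integral> z \<bullet> (Q + \<epsilon> m P1\<inverse>) z\<close> is differentiable in time. Writing \<open>e = Q z\<close>, its derivative
  is bounded, by integration by parts, by the boundary term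
  \<open>- y \<bullet> K y + \<epsilon>/2 m(b) y \<bullet> \<Psi>(b) y\<close> plus \<open>- \<epsilon>/2 \<integral> (m' z \<bullet> Q z - m z \<bullet> B z)\<close>; both are controlled
  for small \<open>\<epsilon>\<close> and suitable \<open>m\<close>, so \<open>V\<close>, which is equivalent to the energy, decays.

  If \<open>\<epsilon>1 < \<epsilon>0\<close>, the choice \<open>\<epsilon> = \<xi> \<epsilon>1\<close> gives a rate with denominator proportional to \<open>X + 2 \<xi> Y\<close>,
  where \<open>X = etaQ muPsi\<close> and \<open>Y = etaK muP1\<close>, and not \<open>Y + 2 \<xi> X\<close> as stated. The stated
  rate is instead reached with \<open>\<epsilon> = \<epsilon>1\<close>: since \<open>2 Y < X\<close>, \<open>\<xi> / (Y + 2 \<xi> X) \<le> 1 / (X + 2 Y)\<close>.\<close>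

section \<open>Quadratic forms and eigenvalues\<close>

text \<open>Two regularity gaps shape the development. A mild solution need not lie in the domain of
  the operator, so the functional cannot be differentiated along it directly. And \<open>Q\<close>
  is only H^1: \<open>Q'\<close> is determined almost everywhere and may be unbounded, so
  \<open>e\<close> and \<open>Q^-1 e\<close> need not have classical derivatives everywhere. Spatial
  calculus is therefore done on pairs of a function and an integrable density, linked by an integral
  equation. The estimates carry three parameters: the weight \<open>\<epsilon>\<close>, a surplus
  \<open>\<delta>\<close> with m' Q - m B \<ge> \<delta> Q, and a relative size r < 1 of \<epsilon>
  m P1^-1 against Q. They give the rate \<epsilon> \<delta> / (1 + r). For the exponential
  multiplier the summand 1 / (b - a) of \<open>\<beta>\<close> produces \<delta> = C etaQ / ((b - a)
  muQ); smallness means \<epsilon> \<le> r \<epsilon>0, the boundary condition means \<epsilon>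
  \<le> \<epsilon>1, and the exponential in the rate is C / mu_m = m(a) / m(b).\<close>

lemma norm_matrix_vector_mult_le:
  fixes A :: "real^'n^'m"
  shows "norm (A *v x) \<le> norm A * norm x"
proof -
  \<comment> \<open>The norm of a matrix is the Euclidean norm of the vector of row norms
    (Frobenius), so Cauchy-Schwarz in each row suffices.\<close>
  have "norm (A *v x) \<le> L2_set (\<lambda>i. norm (A $ i) * norm x) UNIV"
    unfolding norm_vec_def[of "A *v x"]
    by (rule L2_set_mono) (simp_all add: matrix_mult_dot Cauchy_Schwarz_ineq2)
  also have "\<dots> = norm A * norm x"
    by (simp add: L2_set_left_distrib norm_vec_def[of A])
  finally show ?thesis .
qed

lemma abs_matrix_form_le:
  fixes A :: "real^'n^'m"
  shows "\<bar>u \<bullet> (A *v v)\<bar> \<le> norm A * (norm u * norm v)"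
proof -
  have "\<bar>u \<bullet> (A *v v)\<bar> \<le> norm u * norm (A *v v)"
    by (rule Cauchy_Schwarz_ineq2)
  also have "\<dots> \<le> norm u * (norm A * norm v)"
    by (intro mult_left_mono norm_matrix_vector_mult_le) simp
  finally show ?thesis by (simp add: ac_simps)
qed

lemma bilinear_matrix_vector_mult: "bilinear ((*v) :: real^'n^'m \<Rightarrow> real^'n \<Rightarrow> real^'m)"
  unfolding bilinear_def
  by (auto intro!: linearI simp: matrix_vector_mult_add_rdistrib matrix_vector_right_distrib
      matrix_vector_mult_scaleR scaleR_matrix_vector_assoc)

lemma bounded_bilinear_matrix_vector_mult:
  "bounded_bilinear ((*v) :: real^'n^'m \<Rightarrow> real^'n \<Rightarrow> real^'m)"
  using bilinear_matrix_vector_mult bilinear_conv_bounded_bilinear by blast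

lemma transpose_adjoint:
  fixes A :: "real^'n^'m"
  shows "x \<bullet> (A *v y) = (transpose A *v x) \<bullet> y"
  by (simp add: dot_lmul_matrix)

lemma sym_mat_adjoint: "sym_mat A \<Longrightarrow> x \<bullet> (A *v y) = (A *v x) \<bullet> y"
  by (metis sym_mat_def transpose_adjoint)

lemma skew_mat_form: "skew_mat A \<Longrightarrow> x \<bullet> (A *v x) = 0"
proof -
  assume "skew_mat A"
  then have "x \<bullet> (A *v x) = (- A *v x) \<bullet> x"
    by (metis skew_mat_def transpose_adjoint)
  moreover have "- A *v x = - (A *v x)"
    by (metis add.right_inverse matrix_vector_mult_0 matrix_vector_mult_add_rdistrib minus_unique)
  ultimately show ?thesis by (simp add: inner_commute)
qed

lemma transpose_add: "transpose (A + B) = transpose A + transpose B"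
  for A :: "real^'n^'m"
  by (simp add: transpose_def vec_eq_iff)

lemma transpose_diff: "transpose (A - B) = transpose A - transpose B"
  for A :: "real^'n^'m"
  by (simp add: transpose_def vec_eq_iff)

lemma transpose_uminus: "transpose (- A) = - transpose A"
  for A :: "real^'n^'m"
  by (simp add: transpose_def vec_eq_iff)

lemma uminus_matrix_vector_mult: "- A *v x = - (A *v x)"
  for A :: "real^'n^'m"
  using matrix_vector_mult_diff_rdistrib[of 0 A x] by simp

text \<open>Move from \<open>v0\<close> in direction \<open>- S *v v0\<close>: the form is a
  nonnegative quadratic polynomial in the step length with zero constant term, so its linear
  coefficient, a multiple of the squared norm of \<open>S *v v0\<close>, must vanish.\<close>

lemma psd_form_eq_0_imp_ker:
  assumes sym: "sym_mat S" and psd: "\<And>v. v \<bullet> (S *v v) \<ge> 0" and zero: "v0 \<bullet> (S *v v0) = 0"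
  shows "S *v v0 = 0"
proof -
  define w where "w = S *v v0"
  have expand: "2 * t * (w \<bullet> w) \<le> t\<^sup>2 * (w \<bullet> (S *v w))" for t
  proof -
    have "v0 \<bullet> (S *v w) = w \<bullet> w"
      by (simp add: sym_mat_adjoint[OF sym] w_def)
    then have "(v0 - t *\<^sub>R w) \<bullet> (S *v (v0 - t *\<^sub>R w))
        = v0 \<bullet> (S *v v0) - 2 * t * (w \<bullet> w) + t\<^sup>2 * (w \<bullet> (S *v w))"
      by (simp add: matrix_vector_mult_diff_distrib matrix_vector_mult_scaleR inner_diff_left
          inner_diff_right w_def[symmetric] inner_commute power2_eq_square algebra_simps)
    then show ?thesis using psd[of "v0 - t *\<^sub>R w"] zero by simp
  qed
  have "w \<bullet> w \<le> 0"
  proof (cases "w \<bullet> (S *v w) > 0")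
    case False
    with expand[of 1] show ?thesis by simp
  next
    case True
    \<comment> \<open>This step length minimises the quadratic polynomial.\<close>
    with expand[of "(w \<bullet> w) / (w \<bullet> (S *v w))"]
    have "2 * (w \<bullet> w)\<^sup>2 \<le> (w \<bullet> w)\<^sup>2"
      by (simp add: field_simps power2_eq_square)
    then have "(w \<bullet> w)\<^sup>2 \<le> 0" by linarith
    then show ?thesis by simp
  qed
  then have "w = 0" by (metis inner_eq_zero_iff inner_ge_zero order_antisym)
  then show ?thesis by (simp add: w_def)
qed

lemma sym_mat_uminus: "sym_mat A \<Longrightarrow> sym_mat (- A)"
  by (simp add: sym_mat_def transpose_uminus)

text \<open>Maximise the Rayleigh quotient on the unit sphere. With maximum \<open>l\<close>, the
  matrix \<open>l I - A\<close> is positive semidefinite and its form vanishes at the maximiser,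
  which is therefore an eigenvector. Existence of an eigenvalue and the bound on the form come
  together.\<close>

lemma ex_eig_form_le:
  fixes A :: "real^'n^'n"
  assumes sym: "sym_mat A"
  shows "\<exists>l\<in>eig A. \<forall>v. v \<bullet> (A *v v) \<le> l * (norm v)\<^sup>2"
proof -
  have cont: "continuous_on (sphere 0 1) (\<lambda>v. v \<bullet> (A *v v))"
    by (intro continuous_intros linear_continuous_on matrix_vector_mul_bounded_linear)
  obtain u :: "real^'n" where "norm u = 1"
    using norm_axis_1 by blast
  then have "sphere (0::real^'n) 1 \<noteq> {}" by auto
  with continuous_attains_sup[OF compact_sphere this cont]
  obtain v0 where v0: "norm v0 = 1" and max: "\<And>v. norm v = 1 \<Longrightarrow> v \<bullet> (A *v v) \<le> v0 \<bullet> (A *v v0)"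
    by auto
  define l where "l = v0 \<bullet> (A *v v0)"
  have le: "v \<bullet> (A *v v) \<le> l * (norm v)\<^sup>2" for v
  proof (cases "v = 0")
    case False
    have "(v /\<^sub>R norm v) \<bullet> (A *v (v /\<^sub>R norm v)) \<le> l"
      unfolding l_def by (rule max) (use False in simp)
    then show ?thesis
      using False by (simp add: matrix_vector_mult_scaleR field_simps power2_eq_square)
  qed simp
  define S where "S = l *\<^sub>R mat 1 - A"
  have Sv: "S *v v = l *\<^sub>R v - A *v v" for v
    by (simp add: S_def matrix_vector_mult_diff_rdistrib flip: scaleR_matrix_vector_assoc)
  have "sym_mat S"
    using sym by (simp add: S_def sym_mat_def transpose_diff transpose_scalar)
  moreover have "v \<bullet> (S *v v) \<ge> 0" for v
    using le[of v] by (simp add: Sv inner_diff_right power2_norm_eq_inner)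
  moreover have "v0 \<bullet> (S *v v0) = 0"
    using v0 by (simp add: Sv inner_diff_right l_def flip: power2_norm_eq_inner)
  ultimately have "S *v v0 = 0" by (rule psd_form_eq_0_imp_ker)
  then have "A *v v0 = l *\<^sub>R v0" by (simp add: Sv)
  moreover have "v0 \<noteq> 0" using v0 by auto
  ultimately have "l \<in> eig A" by (auto simp: eig_def)
  with le show ?thesis by blast
qed

text \<open>Eigenvectors of distinct eigenvalues are orthogonal, hence independent. Finiteness is
  what makes \<open>max_eig\<close> and \<open>min_eig\<close>, defined by \<open>Max\<close> and
  \<open>Min\<close>, meaningful.\<close>

lemma finite_eig:
  fixes A :: "real^'n^'n"
  assumes sym: "sym_mat A"
  shows "finite (eig A)"
proof -
  define f where "f l = (SOME v. v \<noteq> 0 \<and> A *v v = l *\<^sub>R v)" for l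
  have f: "f l \<noteq> 0 \<and> A *v f l = l *\<^sub>R f l" if "l \<in> eig A" for l
    unfolding f_def by (rule someI_ex) (use that in \<open>auto simp: eig_def\<close>)
  have orth: "f l \<bullet> f m = 0" if "l \<in> eig A" "m \<in> eig A" "l \<noteq> m" for l m
    using sym_mat_adjoint[OF sym, of "f l" "f m"] f[of l] f[of m] that by simp
  have inj: "inj_on f (eig A)"
    by (rule inj_onI) (metis f orth inner_eq_zero_iff)
  have "pairwise orthogonal (f ` eig A)"
    by (auto simp: pairwise_def orthogonal_def intro!: orth)
  moreover have "0 \<notin> f ` eig A" using f by auto
  ultimately have "independent (f ` eig A)"
    by (rule pairwise_orthogonal_independent)
  then have "finite (f ` eig A)" by (rule independent_imp_finite)
  then show ?thesis using inj by (rule finite_imageD)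
qed

lemma eig_nonempty: "sym_mat A \<Longrightarrow> eig A \<noteq> {}"
  using ex_eig_form_le by fastforce

lemma form_le_max_eig:
  assumes "sym_mat A"
  shows "v \<bullet> (A *v v) \<le> max_eig A * (norm v)\<^sup>2"
proof -
  obtain l where l: "l \<in> eig A" "v \<bullet> (A *v v) \<le> l * (norm v)\<^sup>2"
    using ex_eig_form_le[OF assms] by blast
  have "l \<le> max_eig A"
    unfolding max_eig_def using finite_eig[OF assms] l(1) by (rule Max_ge)
  then show ?thesis using l(2) by (meson mult_right_mono order_trans zero_le_power2)
qed

text \<open>The Rayleigh bound for \<open>- A\<close>, whose eigenvalues are the negated eigenvalues
  of \<open>A\<close>.\<close>

lemma min_eig_le_form:
  assumes "sym_mat A"
  shows "min_eig A * (norm v)\<^sup>2 \<le> v \<bullet> (A *v v)"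
proof -
  obtain l where l: "l \<in> eig (- A)" "v \<bullet> (- A *v v) \<le> l * (norm v)\<^sup>2"
    using ex_eig_form_le[OF sym_mat_uminus[OF assms]] by blast
  have "- l \<in> eig A"
    using l(1) by (auto simp: eig_def uminus_matrix_vector_mult) (metis minus_minus)
  then have "min_eig A \<le> - l"
    unfolding min_eig_def using finite_eig[OF assms] by (intro Min_le)
  then have "min_eig A * (norm v)\<^sup>2 \<le> - l * (norm v)\<^sup>2"
    by (intro mult_right_mono) simp_all
  then show ?thesis using l(2) by (simp add: uminus_matrix_vector_mult)
qed

text \<open>Evaluate at an eigenvector of the largest eigenvalue. Together with its counterpart for
  \<open>min_eig\<close>, this shows that the families under the suprema and infima are
  bounded.\<close>

lemma max_eig_le:
  assumes "sym_mat A" and le: "\<And>v. v \<bullet> (A *v v) \<le> c * (norm v)\<^sup>2"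
  shows "max_eig A \<le> c"
proof -
  have "max_eig A \<in> eig A"
    unfolding max_eig_def by (intro Max_in finite_eig eig_nonempty assms)
  then obtain v where "v \<noteq> 0" "A *v v = max_eig A *\<^sub>R v" by (auto simp: eig_def)
  with le[of v] show ?thesis by (simp flip: power2_norm_eq_inner)
qed

lemma min_eig_ge:
  assumes "sym_mat A" and le: "\<And>v. c * (norm v)\<^sup>2 \<le> v \<bullet> (A *v v)"
  shows "c \<le> min_eig A"
proof -
  have "min_eig A \<in> eig A"
    unfolding min_eig_def by (intro Min_in finite_eig eig_nonempty assms)
  then obtain v where "v \<noteq> 0" "A *v v = min_eig A *\<^sub>R v" by (auto simp: eig_def)
  with le[of v] show ?thesis by (simp flip: power2_norm_eq_inner)
qed

lemma pos_def_sym: "pos_def A \<Longrightarrow> sym_mat A"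
  by (simp add: pos_def_def)

lemma pos_def_min_eig_pos:
  assumes "pos_def A" shows "0 < min_eig A"
proof -
  have "min_eig A \<in> eig A"
    unfolding min_eig_def by (intro Min_in finite_eig eig_nonempty pos_def_sym assms)
  then obtain v where v: "v \<noteq> 0" "A *v v = min_eig A *\<^sub>R v" by (auto simp: eig_def)
  moreover have "v \<bullet> (A *v v) > 0" using assms v(1) by (simp add: pos_def_def)
  ultimately have "min_eig A * (v \<bullet> v) > 0" by simp
  then show ?thesis by (metis inner_ge_zero not_less zero_less_mult_iff)
qed

section \<open>Two-sided matrix inverses\<close>

lemma matrix_inv_works:
  fixes A :: "real^'n^'m"
  assumes "A ** B = mat 1" "B ** A = mat 1"
  shows "A ** matrix_inv A = mat 1" "matrix_inv A ** A = mat 1"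
  using someI[of "\<lambda>B. A ** B = mat 1 \<and> B ** A = mat 1" B] assms
  by (auto simp: matrix_inv_def)

text \<open>Row and column index types may differ, as for \<open>stack W1 W1t\<close>. Full rank
  gives a left inverse by injectivity and a right inverse by surjectivity; associativity identifies
  them.\<close>

lemma matrix_inv_full_rank:
  fixes A :: "real^'n^'m"
  assumes "rank A = CARD('n)" "CARD('m) = CARD('n)"
  shows "A ** matrix_inv A = mat 1" "matrix_inv A ** A = mat 1"
proof -
  obtain B where B: "B ** A = mat 1"
    using assms full_rank_injective matrix_left_invertible_injective by blast
  obtain B' where B': "A ** B' = mat 1"
    using assms full_rank_surjective[of A] matrix_right_invertible_surjective[of A] by auto
  have "B = B'" by (metis B B' matrix_mul_assoc matrix_mul_lid matrix_mul_rid)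
  with B B' show "A ** matrix_inv A = mat 1" "matrix_inv A ** A = mat 1"
    by (auto intro: matrix_inv_works)
qed

lemma sym_mat_inverse:
  fixes A B :: "real^'n^'n"
  assumes "sym_mat A" "A ** B = mat 1" "B ** A = mat 1"
  shows "sym_mat B"
proof -
  have "transpose B ** A = mat 1"
    by (metis assms(1,2) matrix_transpose_mul sym_mat_def transpose_mat)
  then have "transpose B = B"
    by (metis assms(2) matrix_mul_assoc matrix_mul_lid matrix_mul_rid)
  then show ?thesis by (simp add: sym_mat_def)
qed

lemma pos_def_matrix_inv:
  assumes "pos_def A"
  shows "A ** matrix_inv A = mat 1" "matrix_inv A ** A = mat 1"
proof -
  have "A *v x = 0 \<Longrightarrow> x = 0" for x
    using assms unfolding pos_def_def by (metis inner_zero_right less_irrefl)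
  then obtain B where "B ** A = mat 1" using matrix_left_invertible_ker by blast
  moreover from this have "A ** B = mat 1" using matrix_left_right_inverse by blast
  ultimately show "A ** matrix_inv A = mat 1" "matrix_inv A ** A = mat 1"
    by (auto intro: matrix_inv_works)
qed

section \<open>Absolutely continuous functions\<close>

text \<open>Absolute continuity with density \<open>g\<close>, in integral form because
  \<open>g\<close> is only determined almost everywhere. Integrability of \<open>g\<close> is all
  that integration by parts uses, and it survives products with continuous functions.\<close>

definition AC_deriv ::
  "real \<Rightarrow> real \<Rightarrow> (real \<Rightarrow> 'v::euclidean_space) \<Rightarrow> (real \<Rightarrow> 'v) \<Rightarrow> bool" where
  "AC_deriv a b F g \<longleftrightarrow>
     g absolutely_integrable_on {a..b} \<and> (\<forall>x\<in>{a..b}. F x = F a + integral {a..x} g)"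

lemma integrable_lebesgue_on_Icc_iff:
  fixes f :: "real \<Rightarrow> 'v::euclidean_space"
  shows "integrable (lebesgue_on {a..b}) f \<longleftrightarrow> f absolutely_integrable_on {a..b}"
  by (simp add: integrable_restrict_space set_integrable_def)

text \<open>The interval has finite measure and r \<le> 1 + r^2.\<close>

lemma L2_fun_absolutely_integrable:
  assumes "L2_fun a b f"
  shows "f absolutely_integrable_on {a..b}"
proof -
  have "integrable (lebesgue_on {a..b}) (\<lambda>x. 1 + (norm (f x))\<^sup>2)"
    using assms unfolding L2_fun_def
    by (intro Bochner_Integration.integrable_add) (auto simp: integrable_lebesgue_on_Icc_iff)
  moreover have "r \<le> 1 + r\<^sup>2" for r :: real
    using zero_le_power2[of "r - 1/2"] by (simp add: power2_eq_square algebra_simps)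
  ultimately have "integrable (lebesgue_on {a..b}) f"
    using assms unfolding L2_fun_def
    by (intro Bochner_Integration.integrable_bound[where f = "\<lambda>x. 1 + (norm (f x))\<^sup>2" and g = f])
      (simp_all add: AE_I2)
  then show ?thesis by (simp add: integrable_lebesgue_on_Icc_iff)
qed

lemma absolutely_integrable_on_Icc_subset:
  fixes f :: "real \<Rightarrow> 'v::euclidean_space"
  assumes "f absolutely_integrable_on {a..b}" "a \<le> x" "y \<le> b"
  shows "f absolutely_integrable_on {x..y}"
  using assms(2,3) by (simp add: absolutely_integrable_on_subinterval[OF assms(1)])

text \<open>Passage from the Lebesgue integral in \<open>H1_deriv\<close> to the gauge integral, in
  which the calculus rules are proved.\<close>

lemma H1_deriv_imp_AC_deriv:
  assumes "H1_deriv a b w w'"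
  shows "AC_deriv a b w w'"
proof -
  have ai: "w' absolutely_integrable_on {a..b}"
    using assms unfolding H1_deriv_def by (intro L2_fun_absolutely_integrable) simp
  have "(LINT s|lebesgue_on {a..x}. w' s) = integral {a..x} w'" if "x \<in> {a..b}" for x
  proof -
    have "w' absolutely_integrable_on {a..x}"
      using that by (intro absolutely_integrable_on_Icc_subset[OF ai]) simp_all
    then have "integrable (lebesgue_on {a..x}) w'"
      by (simp only: integrable_lebesgue_on_Icc_iff)
    then show ?thesis
      by (rule lebesgue_integral_eq_integral) simp
  qed
  then show ?thesis
    using assms ai unfolding AC_deriv_def H1_deriv_def by metis
qed

lemma AC_deriv_eq: "AC_deriv a b F g \<Longrightarrow> x \<in> {a..b} \<Longrightarrow> F x = F a + integral {a..x} g"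
  unfolding AC_deriv_def by blast

lemma AC_deriv_integrable: "AC_deriv a b F g \<Longrightarrow> g absolutely_integrable_on {a..b}"
  unfolding AC_deriv_def by blast

lemma AC_deriv_diff:
  assumes F: "AC_deriv a b F g" and "a \<le> x" "x \<le> y" "y \<le> b"
  shows "F y - F x = integral {x..y} g"
proof -
  have "g absolutely_integrable_on {a..y}"
    using absolutely_integrable_on_Icc_subset[OF AC_deriv_integrable[OF F], of a y] assms(2-4) by simp
  then have "integral {a..x} g + integral {x..y} g = integral {a..y} g"
    using assms(2-4) by (intro Henstock_Kurzweil_Integration.integral_combine) (simp_all add: absolutely_integrable_on_def)
  moreover have "F x = F a + integral {a..x} g" "F y = F a + integral {a..y} g"
    using assms(2-4) by (auto intro: AC_deriv_eq[OF F])
  moreover have "F y - F x = integral {a..y} g - integral {a..x} g"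
    using calculation(2,3) by (metis add_diff_cancel_left)
  ultimately show ?thesis by (metis add_diff_cancel_left')
qed

lemma AC_deriv_continuous:
  assumes F: "AC_deriv a b F g"
  shows "continuous_on {a..b} F"
proof -
  have "g integrable_on {a..b}"
    using AC_deriv_integrable[OF F] by (simp add: absolutely_integrable_on_def)
  then have "continuous_on {a..b} (\<lambda>x. F a + integral {a..x} g)"
    by (intro continuous_intros indefinite_integral_continuous_1)
  then show ?thesis
    by (rule continuous_on_eq) (rule AC_deriv_eq[OF F, symmetric])
qed

lemma uniformly_continuous_on_Icc:
  fixes f :: "real \<Rightarrow> 'v::metric_space"
  assumes "continuous_on {a..b} f" "e > 0"
  shows "\<exists>d>0. \<forall>x\<in>{a..b}. \<forall>y\<in>{a..b}. \<bar>y - x\<bar> < d \<longrightarrow> dist (f y) (f x) < e"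
  using compact_uniformly_continuous[OF assms(1) compact_Icc] assms(2)
  unfolding uniformly_continuous_on_def dist_real_def by blast

text \<open>The error bound \<open>e * integral {x..y} k\<close> is additive in the interval, so it can be summed over
  short steps.\<close>

lemma AC_derivI:
  fixes F g k :: "real \<Rightarrow> real"
  assumes g: "g absolutely_integrable_on {a..b}" and k: "k absolutely_integrable_on {a..b}"
    and incr: "\<And>e. e > 0 \<Longrightarrow> \<exists>d>0. \<forall>x y. a \<le> x \<longrightarrow> x \<le> y \<longrightarrow> y \<le> b \<longrightarrow> y - x < d \<longrightarrow>
      \<bar>F y - F x - integral {x..y} g\<bar> \<le> e * integral {x..y} k"
  shows "AC_deriv a b F g"
proof -
  have int: "f integrable_on {x..y}" if "f absolutely_integrable_on {a..b}" "a \<le> x" "y \<le> b"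
    for x y and f :: "real \<Rightarrow> real"
    using absolutely_integrable_on_Icc_subset[OF that] by (simp add: absolutely_integrable_on_def)
  have bound: "\<bar>F x - F a - integral {a..x} g\<bar> \<le> e * integral {a..x} k"
    if e: "e > 0" and x: "x \<in> {a..b}" for e x
  proof -
    obtain d where "d > 0" and d: "\<And>x y. a \<le> x \<Longrightarrow> x \<le> y \<Longrightarrow> y \<le> b \<Longrightarrow> y - x < d \<Longrightarrow>
      \<bar>F y - F x - integral {x..y} g\<bar> \<le> e * integral {x..y} k"
      using incr[OF e] by blast
    \<comment> \<open>Induction on the number of steps of length \<open>d / 2\<close> needed to
      cover the interval.\<close>
    have steps: "\<bar>F y - F x - integral {x..y} g\<bar> \<le> e * integral {x..y} k"
      if "a \<le> x" "x \<le> y" "y \<le> b" "y - x \<le> real n * (d / 2)" for n x y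
      using that
    proof (induction n arbitrary: x)
      case 0
      then show ?case using d[of x y] \<open>d > 0\<close> by simp
    next
      case (Suc n)
      show ?case
      proof (cases "y - x < d")
        case True
        then show ?thesis using d Suc.prems by blast
      next
        case False
        \<comment> \<open>Half of \<open>d\<close>, so that the step is strictly shorter than
          \<open>d\<close>.\<close>
        define c where "c = x + d / 2"
        have c: "x \<le> c" "c \<le> y" "c - x < d" using False \<open>d > 0\<close> by (auto simp: c_def)
        have "\<bar>F y - F c - integral {c..y} g\<bar> \<le> e * integral {c..y} k"
          by (rule Suc.IH) (use Suc.prems c in \<open>auto simp: c_def algebra_simps\<close>)
        moreover have "\<bar>F c - F x - integral {x..c} g\<bar> \<le> e * integral {x..c} k"
          by (rule d) (use Suc.prems c in auto)
        moreover have "integral {x..c} g + integral {c..y} g = integral {x..y} g"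
          "integral {x..c} k + integral {c..y} k = integral {x..y} k"
          using c Suc.prems by (auto intro!: Henstock_Kurzweil_Integration.integral_combine int g k)
        moreover from this(2)
        have "e * integral {x..c} k + e * integral {c..y} k = e * integral {x..y} k"
          by (metis distrib_left)
        ultimately show ?thesis by linarith
      qed
    qed
    obtain n where "(x - a) / (d / 2) \<le> real n" using real_arch_simple by blast
    then show ?thesis
      using \<open>d > 0\<close> x by (intro steps[where n = n]) (auto simp: field_simps)
  qed
  have "F x = F a + integral {a..x} g" if x: "x \<in> {a..b}" for x
  proof -
    have "\<bar>F x - F a - integral {a..x} g\<bar> \<le> 0 + r" if "r > 0" for r
    proof -
      \<comment> \<open>The summand 1 keeps the denominator positive when the integral of
        \<open>k\<close> vanishes.\<close>
      have "r / (\<bar>integral {a..x} k\<bar> + 1) > 0" using that by simp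
      from bound[OF this x]
      have "\<bar>F x - F a - integral {a..x} g\<bar> \<le> r / (\<bar>integral {a..x} k\<bar> + 1) * integral {a..x} k" .
      also have "\<dots> \<le> r / (\<bar>integral {a..x} k\<bar> + 1) * (\<bar>integral {a..x} k\<bar> + 1)"
        using that by (intro mult_left_mono) auto
      also have "\<dots> = r" by (simp add: add_nonneg_eq_0_iff)
      finally show ?thesis by simp
    qed
    from field_le_epsilon[OF this] show ?thesis by auto
  qed
  with g show ?thesis unfolding AC_deriv_def by blast
qed

text \<open>The common engine of the calculus rules. An algebraic identity writes the increment of
  \<open>F\<close> over \<open>{x..y}\<close> exactly as the integral of a kernel
  \<open>h x y\<close>, which is \<open>g\<close> with its continuous coefficients frozen at
  endpoint values. Uniform continuity of these coefficients makes \<open>h x y\<close> close to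
  \<open>g\<close> on short intervals, relative to an integrable \<open>k\<close>. No pointwise
  differentiability enters.\<close>

lemma AC_derivI_kernel:
  fixes F g k :: "real \<Rightarrow> real"
  assumes g: "g absolutely_integrable_on {a..b}" and k: "k absolutely_integrable_on {a..b}"
    and h: "\<And>x y. a \<le> x \<Longrightarrow> x \<le> y \<Longrightarrow> y \<le> b \<Longrightarrow> (h x y has_integral (F y - F x)) {x..y}"
    and close: "\<And>e. e > 0 \<Longrightarrow> \<exists>d>0. \<forall>x y s. a \<le> x \<longrightarrow> x \<le> s \<longrightarrow> s \<le> y \<longrightarrow> y \<le> b \<longrightarrow> y - x < d \<longrightarrow>
      \<bar>h x y s - g s\<bar> \<le> e * k s"
  shows "AC_deriv a b F g"
proof (rule AC_derivI[OF g k])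
  fix e :: real assume "e > 0"
  from close[OF this] obtain d where "d > 0"
    and d: "\<And>x y s. a \<le> x \<Longrightarrow> x \<le> s \<Longrightarrow> s \<le> y \<Longrightarrow> y \<le> b \<Longrightarrow> y - x < d \<Longrightarrow> \<bar>h x y s - g s\<bar> \<le> e * k s"
    by blast
  have "\<bar>F y - F x - integral {x..y} g\<bar> \<le> e * integral {x..y} k"
    if xy: "a \<le> x" "x \<le> y" "y \<le> b" "y - x < d" for x y
  proof -
    have int: "g integrable_on {x..y}" "k integrable_on {x..y}"
      using absolutely_integrable_on_Icc_subset[OF g] absolutely_integrable_on_Icc_subset[OF k] xy
      by (auto simp: absolutely_integrable_on_def)
    have "((\<lambda>s. h x y s - g s) has_integral (F y - F x - integral {x..y} g)) {x..y}"
      by (intro has_integral_diff h xy integrable_integral int)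
    then have "integral {x..y} (\<lambda>s. h x y s - g s) = F y - F x - integral {x..y} g"
      "(\<lambda>s. h x y s - g s) integrable_on {x..y}" by (auto simp: has_integral_iff)
    moreover have "norm (integral {x..y} (\<lambda>s. h x y s - g s)) \<le> integral {x..y} (\<lambda>s. e * k s)"
      using calculation(2) integrable_on_mult_right[OF int(2), of e]
      by (rule integral_norm_bound_integral) (use xy in \<open>auto intro: d\<close>)
    ultimately show ?thesis by simp
  qed
  with \<open>d > 0\<close> show "\<exists>d>0. \<forall>x y. a \<le> x \<longrightarrow> x \<le> y \<longrightarrow> y \<le> b \<longrightarrow> y - x < d \<longrightarrow>
      \<bar>F y - F x - integral {x..y} g\<bar> \<le> e * integral {x..y} k" by blast
qed

section \<open>Calculus rules for absolutely continuous functions\<close>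

lemma continuous_on_measurable_Icc:
  fixes f :: "real \<Rightarrow> 'v::euclidean_space"
  shows "continuous_on {a..b} f \<Longrightarrow> f \<in> borel_measurable (lebesgue_on {a..b})"
  by (rule continuous_imp_measurable_on_sets_lebesgue) auto

lemma absolutely_integrable_continuous_mult:
  fixes h :: "'u::euclidean_space \<Rightarrow> 'v::euclidean_space \<Rightarrow> 'w::euclidean_space"
  assumes "bilinear h" "continuous_on {a..b::real} f" "g absolutely_integrable_on {a..b}"
  shows "(\<lambda>x. h (f x) (g x)) absolutely_integrable_on {a..b}"
  by (rule absolutely_integrable_bounded_measurable_product[OF assms(1) _ _ _ assms(3)])
    (use assms(2) in \<open>auto intro!: continuous_on_measurable_Icc compact_imp_bounded compact_continuous_image\<close>)

lemma bilinear_inner: "bilinear (inner :: 'v::euclidean_space \<Rightarrow> 'v \<Rightarrow> real)"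
  using bounded_bilinear_inner bilinear_conv_bounded_bilinear by blast

lemma AC_deriv_has_integral:
  assumes "AC_deriv a b F g" "a \<le> x" "x \<le> y" "y \<le> b"
  shows "(g has_integral (F y - F x)) {x..y}"
proof -
  have "g absolutely_integrable_on {x..y}"
    by (rule absolutely_integrable_on_Icc_subset[OF AC_deriv_integrable[OF assms(1)] assms(2,4)])
  then show ?thesis using AC_deriv_diff[OF assms]
    by (simp add: has_integral_iff absolutely_integrable_on_def)
qed

text \<open>The increment of the product is (u y - u x) \<bullet> v y + u x \<bullet> (v y - v x),
  so the kernel freezes \<open>v\<close> at the right endpoint and \<open>u\<close> at the left
  one.\<close>

lemma AC_deriv_inner:
  assumes u: "AC_deriv a b u u'" and v: "AC_deriv a b v v'"
  shows "AC_deriv a b (\<lambda>x. u x \<bullet> v x) (\<lambda>x. u' x \<bullet> v x + u x \<bullet> v' x)"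
proof (rule AC_derivI_kernel)
  note cu = AC_deriv_continuous[OF u] and cv = AC_deriv_continuous[OF v]
  show "(\<lambda>x. u' x \<bullet> v x + u x \<bullet> v' x) absolutely_integrable_on {a..b}"
    using absolutely_integrable_continuous_mult[OF bilinear_inner cv AC_deriv_integrable[OF u]]
      absolutely_integrable_continuous_mult[OF bilinear_inner cu AC_deriv_integrable[OF v]]
    by (intro set_integral_add) (simp_all add: inner_commute)
  show "(\<lambda>s. norm (u' s) + norm (v' s)) absolutely_integrable_on {a..b}"
    using absolutely_integrable_norm[OF AC_deriv_integrable[OF u]]
      absolutely_integrable_norm[OF AC_deriv_integrable[OF v]]
    by (intro set_integral_add) (simp_all add: o_def)
  show "((\<lambda>s. u' s \<bullet> v y + u x \<bullet> v' s) has_integral (u y \<bullet> v y - u x \<bullet> v x)) {x..y}"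
    if xy: "a \<le> x" "x \<le> y" "y \<le> b" for x y
  proof -
    have "((\<lambda>s. u' s \<bullet> v y) has_integral ((u y - u x) \<bullet> v y)) {x..y}"
      using has_integral_linear[OF AC_deriv_has_integral[OF u xy] bounded_linear_inner_left]
      by (simp add: o_def)
    moreover have "((\<lambda>s. u x \<bullet> v' s) has_integral (u x \<bullet> (v y - v x))) {x..y}"
      using has_integral_linear[OF AC_deriv_has_integral[OF v xy] bounded_linear_inner_right]
      by (simp add: o_def)
    ultimately have "((\<lambda>s. u' s \<bullet> v y + u x \<bullet> v' s) has_integral
        ((u y - u x) \<bullet> v y + u x \<bullet> (v y - v x))) {x..y}"
      by (rule has_integral_add)
    then show ?thesis by (simp add: inner_diff_left inner_diff_right)
  qed
  fix e :: real assume "e > 0"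
  obtain d1 where d1: "d1 > 0" "\<And>x y. x \<in> {a..b} \<Longrightarrow> y \<in> {a..b} \<Longrightarrow> \<bar>y - x\<bar> < d1 \<Longrightarrow> dist (u y) (u x) < e"
    using uniformly_continuous_on_Icc[OF cu \<open>e > 0\<close>] by blast
  obtain d2 where d2: "d2 > 0" "\<And>x y. x \<in> {a..b} \<Longrightarrow> y \<in> {a..b} \<Longrightarrow> \<bar>y - x\<bar> < d2 \<Longrightarrow> dist (v y) (v x) < e"
    using uniformly_continuous_on_Icc[OF cv \<open>e > 0\<close>] by blast
  have "\<bar>u' s \<bullet> v y + u x \<bullet> v' s - (u' s \<bullet> v s + u s \<bullet> v' s)\<bar> \<le> e * (norm (u' s) + norm (v' s))"
    if s: "a \<le> x" "x \<le> s" "s \<le> y" "y \<le> b" "y - x < min d1 d2" for x y s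
  proof -
    have "\<bar>u' s \<bullet> (v y - v s)\<bar> \<le> norm (u' s) * norm (v y - v s)" by (rule Cauchy_Schwarz_ineq2)
    also have "\<dots> \<le> norm (u' s) * e"
      using d2(2)[of s y] s by (intro mult_left_mono) (auto simp: dist_norm)
    finally have 1: "\<bar>u' s \<bullet> (v y - v s)\<bar> \<le> norm (u' s) * e" .
    have "\<bar>(u x - u s) \<bullet> v' s\<bar> \<le> norm (u x - u s) * norm (v' s)" by (rule Cauchy_Schwarz_ineq2)
    also have "\<dots> \<le> e * norm (v' s)"
      using d1(2)[of s x] s by (intro mult_right_mono) (auto simp: dist_norm)
    finally have 2: "\<bar>(u x - u s) \<bullet> v' s\<bar> \<le> e * norm (v' s)" .
    have "u' s \<bullet> v y + u x \<bullet> v' s - (u' s \<bullet> v s + u s \<bullet> v' s)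
        = u' s \<bullet> (v y - v s) + (u x - u s) \<bullet> v' s"
      by (simp add: inner_diff_left inner_diff_right)
    then show ?thesis using 1 2 by (simp add: algebra_simps)
  qed
  with d1(1) d2(1) show "\<exists>d>0. \<forall>x y s. a \<le> x \<longrightarrow> x \<le> s \<longrightarrow> s \<le> y \<longrightarrow> y \<le> b \<longrightarrow> y - x < d \<longrightarrow>
      \<bar>u' s \<bullet> v y + u x \<bullet> v' s - (u' s \<bullet> v s + u s \<bullet> v' s)\<bar> \<le> e * (norm (u' s) + norm (v' s))"
    by (intro exI[of _ "min d1 d2"]) auto
qed

lemma AC_deriv_linear:
  fixes h :: "'u::euclidean_space \<Rightarrow> 'v::euclidean_space"
  assumes h: "bounded_linear h" and u: "AC_deriv a b u u'"
  shows "AC_deriv a b (\<lambda>x. h (u x)) (\<lambda>x. h (u' x))"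
proof -
  have "(\<lambda>x. h (u' x)) absolutely_integrable_on {a..b}"
    using absolutely_integrable_linear[OF AC_deriv_integrable[OF u] h] by (simp add: o_def)
  moreover have "h (u x) = h (u a) + integral {a..x} (\<lambda>x. h (u' x))" if x: "x \<in> {a..b}" for x
  proof -
    have "((\<lambda>x. h (u' x)) has_integral h (u x - u a)) {a..x}"
      using has_integral_linear[OF AC_deriv_has_integral[OF u] h, of a x] x by (simp add: o_def)
    then show ?thesis by (simp add: has_integral_iff linear_diff bounded_linear.linear[OF h])
  qed
  ultimately show ?thesis unfolding AC_deriv_def by blast
qed

text \<open>By the mean value theorem the increment of the exponential is \<open>exp t\<close> times
  the increment of \<open>u\<close>, with \<open>t\<close> between the endpoint values; the kernel
  freezes the coefficient at \<open>exp t\<close>. The multipliers are built with this rule.\<close>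

lemma AC_deriv_exp:
  fixes u :: "real \<Rightarrow> real"
  assumes u: "AC_deriv a b u u'"
  shows "AC_deriv a b (\<lambda>x. exp (u x)) (\<lambda>x. exp (u x) * u' x)"
proof (rule AC_derivI_kernel)
  note cu = AC_deriv_continuous[OF u]
  have ce: "continuous_on {a..b} (\<lambda>x. exp (u x))" by (intro continuous_intros cu)
  show "(\<lambda>x. exp (u x) * u' x) absolutely_integrable_on {a..b}"
    by (rule absolutely_integrable_continuous_mult[OF bilinear_times ce AC_deriv_integrable[OF u]])
  show "(\<lambda>s. \<bar>u' s\<bar>) absolutely_integrable_on {a..b}"
    using absolutely_integrable_norm[OF AC_deriv_integrable[OF u]] by (simp add: o_def)
  have mvt: "\<exists>t. min p q \<le> t \<and> t \<le> max p q \<and> exp q - exp p = exp t * (q - p)" for p q :: real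
  proof (cases p q rule: linorder_cases)
    case less
    from MVT2[OF this, of exp exp] show ?thesis by (force simp: mult.commute)
  next
    case greater
    from MVT2[OF this, of exp exp] obtain t where "q < t" "t < p" "exp p - exp q = (p - q) * exp t"
      by auto
    then show ?thesis by (intro exI[of _ t]) (auto simp: algebra_simps)
  qed auto
  \<comment> \<open>The intermediate point depends on the endpoint values alone, so the kernel has a
    coefficient constant in \<open>s\<close>. Using \<open>min\<close> and \<open>max\<close> avoids
    a case split on the order of these values.\<close>
  define t where "t p q = (SOME t. min p q \<le> t \<and> t \<le> max p q \<and> exp q - exp p = exp t * (q - p))"
    for p q :: real
  have t: "min p q \<le> t p q" "t p q \<le> max p q" "exp q - exp p = exp (t p q) * (q - p)" for p q
    using someI_ex[OF mvt[of p q]] by (auto simp: t_def)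
  define c where "c x y = t (u x) (u y)" for x y
  show "((\<lambda>s. exp (c x y) * u' s) has_integral exp (u y) - exp (u x)) {x..y}"
    if xy: "a \<le> x" "x \<le> y" "y \<le> b" for x y
    using has_integral_mult_right[OF AC_deriv_has_integral[OF u xy], of "exp (c x y)"] t(3)[where p = "u x" and q = "u y"]
    by (simp add: c_def)
  fix e :: real assume "e > 0"
  obtain d where d: "d > 0" "\<And>x y. x \<in> {a..b} \<Longrightarrow> y \<in> {a..b} \<Longrightarrow> \<bar>y - x\<bar> < d \<Longrightarrow> dist (exp (u y)) (exp (u x)) < e"
    using uniformly_continuous_on_Icc[OF ce \<open>e > 0\<close>] by blast
  have "\<bar>exp (c x y) * u' s - exp (u s) * u' s\<bar> \<le> e * \<bar>u' s\<bar>"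
    if s: "a \<le> x" "x \<le> s" "s \<le> y" "y \<le> b" "y - x < d" for x y s
  proof -
    have "\<bar>exp (c x y) - exp (u s)\<bar> \<le> e"
    proof -
      \<comment> \<open>\<open>exp (c x y)\<close> lies between the two endpoint values, and both
        are within \<open>e\<close> of \<open>exp (u s)\<close>; the disjunctions say this without
        fixing which endpoint value is larger.\<close>
      have "exp (u x) \<le> exp (c x y) \<or> exp (u y) \<le> exp (c x y)"
        "exp (c x y) \<le> exp (u x) \<or> exp (c x y) \<le> exp (u y)"
        using t(1,2)[where p = "u x" and q = "u y"] by (auto simp: c_def min_def max_def split: if_splits)
      moreover have "\<bar>exp (u x) - exp (u s)\<bar> < e" "\<bar>exp (u y) - exp (u s)\<bar> < e"
        using d(2)[of s x] d(2)[of s y] s by (auto simp: dist_real_def)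
      ultimately show ?thesis by linarith
    qed
    then have "\<bar>exp (c x y) - exp (u s)\<bar> * \<bar>u' s\<bar> \<le> e * \<bar>u' s\<bar>" by (rule mult_right_mono) simp
    then show ?thesis by (simp add: left_diff_distrib flip: abs_mult)
  qed
  with d(1) show "\<exists>d>0. \<forall>x y s. a \<le> x \<longrightarrow> x \<le> s \<longrightarrow> s \<le> y \<longrightarrow> y \<le> b \<longrightarrow> y - x < d \<longrightarrow>
      \<bar>exp (c x y) * u' s - exp (u s) * u' s\<bar> \<le> e * \<bar>u' s\<bar>" by blast
qed

lemma AC_deriv_primitive:
  fixes k :: "real \<Rightarrow> real"
  assumes "k absolutely_integrable_on {a..b}"
  shows "AC_deriv a b (\<lambda>x. integral {a..x} k) k"
  using assms by (simp add: AC_deriv_def)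

section \<open>Lyapunov functionals on $L^2$\<close>

lemma power2_norm_add_le: "(norm (u + v))\<^sup>2 \<le> 2 * (norm u)\<^sup>2 + 2 * (norm v)\<^sup>2"
  for u v :: "'v::real_normed_vector"
proof -
  have "(norm (u + v))\<^sup>2 \<le> (norm u + norm v)\<^sup>2"
    by (intro power_mono norm_triangle_ineq) simp
  also have "\<dots> \<le> 2 * (norm u)\<^sup>2 + 2 * (norm v)\<^sup>2"
    using zero_le_power2[of "norm u - norm v"] by (simp add: power2_eq_square algebra_simps)
  finally show ?thesis .
qed

lemma L2_fun_measurable: "L2_fun a b f \<Longrightarrow> f \<in> borel_measurable (lebesgue_on {a..b})"
  by (simp add: L2_fun_def)

lemma L2_fun_scaleR:
  assumes "L2_fun a b f" shows "L2_fun a b (\<lambda>x. c *\<^sub>R f x)"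
proof -
  have "(\<lambda>x. c *\<^sub>R f x) \<in> borel_measurable (lebesgue_on {a..b})"
    by (intro borel_measurable_scaleR borel_measurable_const L2_fun_measurable assms)
  then show ?thesis
    using assms by (simp add: L2_fun_def power_mult_distrib)
qed

lemma L2_fun_add:
  assumes "L2_fun a b f" "L2_fun a b g" shows "L2_fun a b (\<lambda>x. f x + g x)"
proof -
  have "integrable (lebesgue_on {a..b}) (\<lambda>x. 2 * (norm (f x))\<^sup>2 + 2 * (norm (g x))\<^sup>2)"
    using assms by (simp add: L2_fun_def)
  moreover have "(\<lambda>x. f x + g x) \<in> borel_measurable (lebesgue_on {a..b})"
    by (intro borel_measurable_add L2_fun_measurable assms)
  ultimately show ?thesis
    unfolding L2_fun_def
    by (intro conjI Bochner_Integration.integrable_bound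
        [where f = "\<lambda>x. 2 * (norm (f x))\<^sup>2 + 2 * (norm (g x))\<^sup>2" and g = "\<lambda>x. (norm (f x + g x))\<^sup>2"])
      (simp_all add: power2_norm_add_le)
qed

lemma L2_fun_diff:
  assumes "L2_fun a b f" "L2_fun a b g" shows "L2_fun a b (\<lambda>x. f x - g x)"
  using L2_fun_add[OF assms(1) L2_fun_scaleR[OF assms(2), of "-1"]] by simp

lemma L2_norm_nonneg [simp]: "0 \<le> L2_norm a b f"
  by (simp add: L2_norm_def)

lemma L2_norm_power2: "(L2_norm a b f)\<^sup>2 = (LINT x|lebesgue_on {a..b}. (norm (f x))\<^sup>2)"
  by (simp add: L2_norm_def)

lemma L2_norm_scaleR: "L2_norm a b (\<lambda>x. c *\<^sub>R f x) = \<bar>c\<bar> * L2_norm a b f"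
  by (simp add: L2_norm_def power_mult_distrib real_sqrt_mult)

lemma integrable_norm_mult_norm:
  assumes "L2_fun a b f" "L2_fun a b g"
  shows "integrable (lebesgue_on {a..b}) (\<lambda>x. norm (f x) * norm (g x))"
proof (rule Bochner_Integration.integrable_bound)
  show "integrable (lebesgue_on {a..b}) (\<lambda>x. (norm (f x))\<^sup>2 + (norm (g x))\<^sup>2)"
    using assms by (simp add: L2_fun_def)
  show "(\<lambda>x. norm (f x) * norm (g x)) \<in> borel_measurable (lebesgue_on {a..b})"
    by (intro borel_measurable_times measurable_compose[OF _ borel_measurable_norm]
        L2_fun_measurable[OF assms(1)] L2_fun_measurable[OF assms(2)])
  have "r * s \<le> r\<^sup>2 + s\<^sup>2" if "r \<ge> 0" "s \<ge> 0" for r s :: real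
    using sum_squares_bound[of r s] mult_nonneg_nonneg[OF that] by linarith
  then show "AE x in lebesgue_on {a..b}. norm (norm (f x) * norm (g x)) \<le> norm ((norm (f x))\<^sup>2 + (norm (g x))\<^sup>2)"
    by simp
qed

text \<open>Integrate the normalised inequality 2 p q \<le> p^2 + q^2. The normalising constants
  exceed the norms by \<open>e\<close>, which avoids division by a zero norm; then \<open>e\<close>
  tends to 0.\<close>

lemma L2_Cauchy_Schwarz:
  assumes f: "L2_fun a b f" and g: "L2_fun a b g"
  shows "(LINT x|lebesgue_on {a..b}. norm (f x) * norm (g x)) \<le> L2_norm a b f * L2_norm a b g"
proof -
  define p q where "p = L2_norm a b f" and "q = L2_norm a b g"
  let ?I = "LINT x|lebesgue_on {a..b}. norm (f x) * norm (g x)"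
  have pq: "p \<ge> 0" "q \<ge> 0" by (simp_all add: p_def q_def)
  have bound: "?I \<le> (p + e) * (q + e)" if "e > 0" for e
  proof -
    define P R where "P = p + e" and "R = q + e"
    have PR: "P > 0" "R > 0" using that pq by (auto simp: P_def R_def)
    have "?I \<le> (LINT x|lebesgue_on {a..b}. P * R / 2 * ((norm (f x))\<^sup>2 / P\<^sup>2 + (norm (g x))\<^sup>2 / R\<^sup>2))"
    proof (rule integral_mono[OF integrable_norm_mult_norm[OF f g]])
      show "integrable (lebesgue_on {a..b}) (\<lambda>x. P * R / 2 * ((norm (f x))\<^sup>2 / P\<^sup>2 + (norm (g x))\<^sup>2 / R\<^sup>2))"
        using f g by (simp add: L2_fun_def)
      show "norm (f x) * norm (g x) \<le> P * R / 2 * ((norm (f x))\<^sup>2 / P\<^sup>2 + (norm (g x))\<^sup>2 / R\<^sup>2)" for x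
        using sum_squares_bound[of "norm (f x) / P" "norm (g x) / R"] PR
        by (simp add: power_divide field_simps)
    qed
    also have "\<dots> = P * R / 2 * (p\<^sup>2 / P\<^sup>2 + q\<^sup>2 / R\<^sup>2)"
      using f g by (simp add: L2_fun_def p_def q_def L2_norm_power2)
    also have "\<dots> \<le> P * R / 2 * (1 + 1)"
    proof (intro mult_left_mono add_mono)
      show "p\<^sup>2 / P\<^sup>2 \<le> 1" "q\<^sup>2 / R\<^sup>2 \<le> 1"
        using PR pq that by (auto simp: P_def R_def intro!: power_mono)
    qed (use PR in simp)
    finally show ?thesis by (simp add: P_def R_def)
  qed
  have "((\<lambda>e. (p + e) * (q + e)) \<longlongrightarrow> (p + 0) * (q + 0)) (at_right 0)"
    by (intro tendsto_intros)
  then have "?I \<le> (p + 0) * (q + 0)"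
    by (rule tendsto_lowerbound) (auto simp: eventually_at_right_less bound intro: eventually_at_rightI[of 0 1])
  then show ?thesis by (simp add: p_def q_def)
qed

lemma L2_norm_power2_add_le:
  assumes "L2_fun a b f" "L2_fun a b g"
  shows "(L2_norm a b (\<lambda>x. f x + g x))\<^sup>2 \<le> 2 * (L2_norm a b f)\<^sup>2 + 2 * (L2_norm a b g)\<^sup>2"
proof -
  have "(LINT x|lebesgue_on {a..b}. (norm (f x + g x))\<^sup>2)
      \<le> (LINT x|lebesgue_on {a..b}. 2 * (norm (f x))\<^sup>2 + 2 * (norm (g x))\<^sup>2)"
    using assms L2_fun_add[OF assms]
    by (intro integral_mono) (simp_all add: L2_fun_def power2_norm_add_le)
  also have "\<dots> = 2 * (L2_norm a b f)\<^sup>2 + 2 * (L2_norm a b g)\<^sup>2"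
    using assms by (simp add: L2_fun_def L2_norm_power2)
  finally show ?thesis by (simp add: L2_norm_power2)
qed

text \<open>For convergence to 0 the estimate of the squared norm with the factor 2 does the work of
  the triangle inequality. \<open>S\<close> is the parameter set on which membership in L^2 is
  known.\<close>

lemma L2_norm_tendsto_0_add:
  assumes "\<And>s. s \<in> S \<Longrightarrow> L2_fun a b (u s)" "\<And>s. s \<in> S \<Longrightarrow> L2_fun a b (v s)"
    and "eventually (\<lambda>s. s \<in> S) F"
    and "((\<lambda>s. L2_norm a b (u s)) \<longlongrightarrow> 0) F" "((\<lambda>s. L2_norm a b (v s)) \<longlongrightarrow> 0) F"
  shows "((\<lambda>s. L2_norm a b (\<lambda>x. u s x + v s x)) \<longlongrightarrow> 0) F"
proof -
  have "((\<lambda>s. 2 * (L2_norm a b (u s))\<^sup>2 + 2 * (L2_norm a b (v s))\<^sup>2) \<longlongrightarrow> 2 * 0\<^sup>2 + 2 * 0\<^sup>2) F"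
    by (intro tendsto_intros assms)
  then have "((\<lambda>s. 2 * (L2_norm a b (u s))\<^sup>2 + 2 * (L2_norm a b (v s))\<^sup>2) \<longlongrightarrow> 0) F" by simp
  moreover have "\<forall>\<^sub>F s in F. norm ((L2_norm a b (\<lambda>x. u s x + v s x))\<^sup>2)
      \<le> 2 * (L2_norm a b (u s))\<^sup>2 + 2 * (L2_norm a b (v s))\<^sup>2"
    using assms(3) by eventually_elim (simp add: L2_norm_power2_add_le assms)
  ultimately have "((\<lambda>s. (L2_norm a b (\<lambda>x. u s x + v s x))\<^sup>2) \<longlongrightarrow> 0) F"
    by (rule Lim_null_comparison[rotated])
  then have "((\<lambda>s. sqrt ((L2_norm a b (\<lambda>x. u s x + v s x))\<^sup>2)) \<longlongrightarrow> sqrt 0) F"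
    by (rule tendsto_real_sqrt)
  then show ?thesis by simp
qed

section \<open>Bounded symmetric forms and their decay along mild solutions\<close>

definition L2_form ::
  "real \<Rightarrow> real \<Rightarrow> (real \<Rightarrow> real^'n^'n) \<Rightarrow> (real \<Rightarrow> real^'n) \<Rightarrow> (real \<Rightarrow> real^'n) \<Rightarrow> real" where
  "L2_form a b L u v = (LINT x|lebesgue_on {a..b}. u x \<bullet> (L x *v v x))"

text \<open>The coefficient of a quadratic functional on L^2. It is instantiated with
  \<open>Q\<close>, whose form is twice the energy, and with the Lyapunov weight Q + \<epsilon> m
  P1^-1.\<close>

locale L2_sym_form =
  fixes a b c :: real and L :: "real \<Rightarrow> real^'n^'n"
  assumes meas: "L \<in> borel_measurable (lebesgue_on {a..b})"
    and sym: "\<And>x. x \<in> {a..b} \<Longrightarrow> sym_mat (L x)"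
    and bnd: "\<And>x. x \<in> {a..b} \<Longrightarrow> norm (L x) \<le> c"
    and c_nonneg: "0 \<le> c"
begin

lemma integrable_form:
  assumes u: "L2_fun a b u" and v: "L2_fun a b v"
  shows "integrable (lebesgue_on {a..b}) (\<lambda>x. u x \<bullet> (L x *v v x))"
proof (rule Bochner_Integration.integrable_bound)
  show "integrable (lebesgue_on {a..b}) (\<lambda>x. c * (norm (u x) * norm (v x)))"
    by (intro integrable_mult_right integrable_norm_mult_norm u v)
  have "(\<lambda>x. L x *v v x) \<in> borel_measurable (lebesgue_on {a..b})"
    using v by (intro borel_measurable_bilinear[OF bilinear_matrix_vector_mult meas]) (simp_all add: L2_fun_def)
  then show "(\<lambda>x. u x \<bullet> (L x *v v x)) \<in> borel_measurable (lebesgue_on {a..b})"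
    by (intro borel_measurable_inner L2_fun_measurable[OF u])
  have "norm (u x \<bullet> (L x *v v x)) \<le> norm (c * (norm (u x) * norm (v x)))" if "x \<in> {a..b}" for x
  proof -
    have "norm (u x \<bullet> (L x *v v x)) \<le> norm (L x) * (norm (u x) * norm (v x))"
      using abs_matrix_form_le by simp
    also have "\<dots> \<le> c * (norm (u x) * norm (v x))" by (intro mult_right_mono bnd that) simp
    finally show ?thesis using c_nonneg by simp
  qed
  then show "AE x in lebesgue_on {a..b}. norm (u x \<bullet> (L x *v v x)) \<le> norm (c * (norm (u x) * norm (v x)))"
    by (intro AE_I2) simp
qed

lemma form_bound:
  assumes u: "L2_fun a b u" and v: "L2_fun a b v"
  shows "\<bar>L2_form a b L u v\<bar> \<le> c * (L2_norm a b u * L2_norm a b v)"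
proof -
  have "\<bar>L2_form a b L u v\<bar> \<le> (LINT x|lebesgue_on {a..b}. \<bar>u x \<bullet> (L x *v v x)\<bar>)"
    unfolding L2_form_def by (rule integral_abs_bound)
  also have "\<dots> \<le> (LINT x|lebesgue_on {a..b}. c * (norm (u x) * norm (v x)))"
  proof (rule integral_mono)
    show "integrable (lebesgue_on {a..b}) (\<lambda>x. \<bar>u x \<bullet> (L x *v v x)\<bar>)"
      using integrable_form[OF u v] by (rule integrable_abs)
    show "integrable (lebesgue_on {a..b}) (\<lambda>x. c * (norm (u x) * norm (v x)))"
      by (intro integrable_mult_right integrable_norm_mult_norm u v)
    fix x assume "x \<in> space (lebesgue_on {a..b})"
    then have "norm (L x) * (norm (u x) * norm (v x)) \<le> c * (norm (u x) * norm (v x))"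
      by (intro mult_right_mono bnd) simp_all
    then show "\<bar>u x \<bullet> (L x *v v x)\<bar> \<le> c * (norm (u x) * norm (v x))"
      using abs_matrix_form_le order_trans by blast
  qed
  also have "\<dots> \<le> c * (L2_norm a b u * L2_norm a b v)"
    using L2_Cauchy_Schwarz[OF u v] c_nonneg by (simp add: mult_left_mono)
  finally show ?thesis .
qed

lemma form_add_left:
  assumes "L2_fun a b u" "L2_fun a b v" "L2_fun a b w"
  shows "L2_form a b L (\<lambda>x. u x + v x) w = L2_form a b L u w + L2_form a b L v w"
  using Bochner_Integration.integral_add[OF integrable_form[OF assms(1,3)] integrable_form[OF assms(2,3)]]
  by (simp add: L2_form_def inner_add_left)

lemma form_scale_left:
  shows "L2_form a b L (\<lambda>x. r *\<^sub>R u x) w = r * L2_form a b L u w"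
  by (simp add: L2_form_def)

lemma form_commute: "L2_form a b L u v = L2_form a b L v u"
  unfolding L2_form_def
proof (rule Bochner_Integration.integral_cong)
  fix x assume "x \<in> space (lebesgue_on {a..b})"
  then have "sym_mat (L x)" by (intro sym) simp
  then show "u x \<bullet> (L x *v v x) = v x \<bullet> (L x *v u x)"
    by (metis sym_mat_adjoint inner_commute)
qed simp

text \<open>Source of both continuity of the form, with \<open>r = 1\<close>, and its time
  derivative, with \<open>r = s - t\<close>.\<close>

lemma form_expand:
  assumes u: "L2_fun a b u" and v: "L2_fun a b v"
  shows "L2_form a b L (\<lambda>x. u x + r *\<^sub>R v x) (\<lambda>x. u x + r *\<^sub>R v x)
    = L2_form a b L u u + 2 * r * L2_form a b L v u + r\<^sup>2 * L2_form a b L v v"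
proof -
  note rv = L2_fun_scaleR[OF v, of r]
  note s = L2_fun_add[OF u rv]
  have "L2_form a b L (\<lambda>x. u x + r *\<^sub>R v x) (\<lambda>x. u x + r *\<^sub>R v x)
    = L2_form a b L u (\<lambda>x. u x + r *\<^sub>R v x) + r * L2_form a b L v (\<lambda>x. u x + r *\<^sub>R v x)"
    using form_add_left[OF u rv s] by (simp add: form_scale_left)
  also have "L2_form a b L u (\<lambda>x. u x + r *\<^sub>R v x) = L2_form a b L u u + r * L2_form a b L v u"
    unfolding form_commute[of u "\<lambda>x. u x + r *\<^sub>R v x"] using form_add_left[OF u rv u] by (simp add: form_scale_left)
  also have "L2_form a b L v (\<lambda>x. u x + r *\<^sub>R v x) = L2_form a b L v u + r * L2_form a b L v v"
    unfolding form_commute[of v "\<lambda>x. u x + r *\<^sub>R v x"] form_commute[of v u]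
    using form_add_left[OF u rv v] by (simp add: form_scale_left)
  finally show ?thesis by (simp add: algebra_simps power2_eq_square)
qed

lemma form_tendsto:
  assumes z: "L2_fun a b z" and w: "\<And>s. s \<in> S \<Longrightarrow> L2_fun a b (w s)"
    and S: "eventually (\<lambda>s. s \<in> S) F"
    and lim: "((\<lambda>s. L2_norm a b (\<lambda>x. w s x - z x)) \<longlongrightarrow> 0) F"
  shows "((\<lambda>s. L2_form a b L (w s) (w s)) \<longlongrightarrow> L2_form a b L z z) F"
proof -
  let ?r = "\<lambda>s. L2_norm a b (\<lambda>x. w s x - z x)"
  have "((\<lambda>s. 2 * (c * (?r s * L2_norm a b z)) + c * (?r s * ?r s))
      \<longlongrightarrow> 2 * (c * (0 * L2_norm a b z)) + c * (0 * 0)) F"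
    by (intro tendsto_intros lim)
  then have "((\<lambda>s. 2 * (c * (?r s * L2_norm a b z)) + c * (?r s * ?r s)) \<longlongrightarrow> 0) F"
    by simp
  moreover have "\<forall>\<^sub>F s in F. norm (L2_form a b L (w s) (w s) - L2_form a b L z z)
      \<le> 2 * (c * (?r s * L2_norm a b z)) + c * (?r s * ?r s)"
    using S
  proof eventually_elim
    case (elim s)
    note d = L2_fun_diff[OF w[OF elim] z]
    have "L2_form a b L (w s) (w s) = L2_form a b L z z
        + 2 * L2_form a b L (\<lambda>x. w s x - z x) z + L2_form a b L (\<lambda>x. w s x - z x) (\<lambda>x. w s x - z x)"
      using form_expand[OF z d, of 1] by simp
    then show ?case using form_bound[OF d z] form_bound[OF d d] by auto
  qed
  ultimately have "((\<lambda>s. L2_form a b L (w s) (w s) - L2_form a b L z z) \<longlongrightarrow> 0) F"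
    by (rule Lim_null_comparison[rotated])
  then show ?thesis by (simp add: LIM_zero_iff)
qed

text \<open>With \<open>d\<close> the difference quotient of \<open>w\<close>, the quotient of the
  form is 2 <d, w t> + (s - t) <d, d>. Since \<open>d\<close> tends to \<open>f\<close> in L^2, the
  second term vanishes and the first tends to 2 <f, w t>.\<close>

lemma form_has_derivative:
  assumes w: "\<And>s. s \<in> S \<Longrightarrow> L2_fun a b (w s)" and t: "t \<in> S" and f: "L2_fun a b f"
    and lim: "((\<lambda>s. L2_norm a b (\<lambda>x. (w s x - w t x) /\<^sub>R (s - t) - f x)) \<longlongrightarrow> 0) (at t within S)"
  shows "((\<lambda>s. L2_form a b L (w s) (w s)) has_real_derivative 2 * L2_form a b L f (w t)) (at t within S)"
proof -
  define r where "r s = L2_norm a b (\<lambda>x. (w s x - w t x) /\<^sub>R (s - t) - f x)" for s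
  let ?E = "\<lambda>s. L2_form a b L (w s) (w s)"
  let ?nf = "L2_norm a b f" and ?nw = "L2_norm a b (w t)"
  have "((\<lambda>s. 2 * (c * (r s * ?nw)) + \<bar>s - t\<bar> * (c * (2 * (r s)\<^sup>2 + 2 * ?nf\<^sup>2)))
      \<longlongrightarrow> 2 * (c * (0 * ?nw)) + \<bar>t - t\<bar> * (c * (2 * 0\<^sup>2 + 2 * ?nf\<^sup>2))) (at t within S)"
    by (intro tendsto_intros lim[folded r_def])
  then have "((\<lambda>s. 2 * (c * (r s * ?nw)) + \<bar>s - t\<bar> * (c * (2 * (r s)\<^sup>2 + 2 * ?nf\<^sup>2))) \<longlongrightarrow> 0) (at t within S)"
    by simp
  moreover have "\<forall>\<^sub>F s in at t within S. norm ((?E s - ?E t) / (s - t) - 2 * L2_form a b L f (w t))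
      \<le> 2 * (c * (r s * ?nw)) + \<bar>s - t\<bar> * (c * (2 * (r s)\<^sup>2 + 2 * ?nf\<^sup>2))"
    unfolding eventually_at_topological
  proof (intro exI[of _ UNIV] conjI ballI impI, simp_all, goal_cases)
    case (1 s)
    define d where "d x = (w s x - w t x) /\<^sub>R (s - t)" for x
    define g where "g x = d x - f x" for x
    have d: "L2_fun a b d" unfolding d_def
      by (intro L2_fun_scaleR L2_fun_diff w 1 t)
    have g: "L2_fun a b g" unfolding g_def by (intro L2_fun_diff d f)
    have r: "r s = L2_norm a b g" unfolding r_def g_def[abs_def] d_def[abs_def] ..
    have ws: "w s = (\<lambda>x. w t x + (s - t) *\<^sub>R d x)" using 1 by (auto simp: d_def)
    have E: "?E s = ?E t + 2 * (s - t) * L2_form a b L d (w t) + (s - t)\<^sup>2 * L2_form a b L d d"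
      unfolding ws by (rule form_expand[OF w[OF t] d])
    have "(?E s - ?E t) / (s - t) = (s - t) * (2 * L2_form a b L d (w t) + (s - t) * L2_form a b L d d) / (s - t)"
      unfolding E by (simp add: power2_eq_square algebra_simps)
    then have q: "(?E s - ?E t) / (s - t) = 2 * L2_form a b L d (w t) + (s - t) * L2_form a b L d d"
      using 1 by simp
    have dg: "L2_form a b L d (w t) = L2_form a b L f (w t) + L2_form a b L g (w t)"
      using form_add_left[OF f g w[OF t]] by (simp add: g_def)
    have "(L2_norm a b d)\<^sup>2 \<le> 2 * (r s)\<^sup>2 + 2 * ?nf\<^sup>2"
      using L2_norm_power2_add_le[OF g f] unfolding r by (simp add: g_def)
    then have "c * (L2_norm a b d)\<^sup>2 \<le> c * (2 * (r s)\<^sup>2 + 2 * ?nf\<^sup>2)"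
      using c_nonneg by (rule mult_left_mono)
    then have "\<bar>L2_form a b L d d\<bar> \<le> c * (2 * (r s)\<^sup>2 + 2 * ?nf\<^sup>2)"
      using form_bound[OF d d] by (simp add: power2_eq_square)
    then have "\<bar>(s - t) * L2_form a b L d d\<bar> \<le> \<bar>s - t\<bar> * (c * (2 * (r s)\<^sup>2 + 2 * ?nf\<^sup>2))"
      by (simp add: abs_mult mult_left_mono)
    moreover have "\<bar>L2_form a b L g (w t)\<bar> \<le> c * (r s * ?nw)"
      unfolding r by (rule form_bound[OF g w[OF t]])
    moreover have "\<bar>2 * (p + q) + r - 2 * p\<bar> \<le> 2 * B + D" if "\<bar>r\<bar> \<le> D" "\<bar>q\<bar> \<le> B"
      for p q r B D :: real using that by (simp add: abs_le_iff)
    ultimately show ?case unfolding q dg by blast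
  qed
  ultimately have "((\<lambda>s. (?E s - ?E t) / (s - t) - 2 * L2_form a b L f (w t)) \<longlongrightarrow> 0) (at t within S)"
    by (rule Lim_null_comparison[rotated])
  then show ?thesis by (simp add: has_field_derivative_iff LIM_zero_iff)
qed

text \<open>A mild solution is the limit of the difference quotients \<open>(Z (t + h) - Z t) / h\<close>, which are
  strict solutions, so that the Lyapunov functional may be differentiated along them.\<close>

lemma mild_solution_form_decay:
  fixes A :: "(real \<Rightarrow> real^'n) \<Rightarrow> (real \<Rightarrow> real^'n) \<Rightarrow> bool"
  assumes A_diff: "\<And>u f v g. A u f \<Longrightarrow> A v g \<Longrightarrow> A (\<lambda>x. u x - v x) (\<lambda>x. f x - g x)"
    and A_scale: "\<And>r u f. A u f \<Longrightarrow> A (\<lambda>x. r *\<^sub>R u x) (\<lambda>x. r *\<^sub>R f x)"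
    and dissip: "\<And>u f. A u f \<Longrightarrow> 2 * L2_form a b L f u \<le> - \<alpha> * L2_form a b L u u"
    and sol: "mild_solution a b A z" and t: "0 \<le> t"
  shows "L2_form a b L (z t) (z t) \<le> exp (- \<alpha> * t) * L2_form a b L (z 0) (z 0)"
proof -
  have zL2: "L2_fun a b (z s)" if "s \<ge> 0" for s
    using sol that by (auto simp: mild_solution_def)
  obtain Z where ZL2: "\<And>s. s \<ge> 0 \<Longrightarrow> L2_fun a b (Z s)"
    and Zd: "\<And>t. t \<ge> 0 \<Longrightarrow>
      ((\<lambda>s. L2_norm a b (\<lambda>x. (Z s x - Z t x) /\<^sub>R (s - t) - z t x)) \<longlongrightarrow> 0) (at t within {0..})"
    and ZA: "\<And>s. s \<ge> 0 \<Longrightarrow> A (Z s) (\<lambda>x. z s x - z 0 x)"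
    using sol unfolding mild_solution_def by blast
  define w where "w h s x = (Z (s + h) x - Z s x) /\<^sub>R h" for h s x
  have wL2: "L2_fun a b (w h s)" if "h > 0" "s \<ge> 0" for h s
    unfolding w_def using that by (intro L2_fun_scaleR L2_fun_diff ZL2) auto
  have decay: "L2_form a b L (w h t) (w h t) \<le> exp (- \<alpha> * t) * L2_form a b L (w h 0) (w h 0)"
    if h: "h > 0" for h
  proof -
    define f where "f s x = (z (s + h) x - z s x) /\<^sub>R h" for s x
    \<comment> \<open>The initial state cancels in the difference, so \<open>A\<close> maps
      increments of \<open>Z\<close> to increments of \<open>z\<close>; these are also h times the
      time derivative of \<open>w h\<close>.\<close>
    have wA: "A (w h s) (f s)" if "s \<ge> 0" for s
    proof -
      have "A (\<lambda>x. Z (s + h) x - Z s x) (\<lambda>x. (z (s + h) x - z 0 x) - (z s x - z 0 x))"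
        by (intro A_diff ZA) (use that h in auto)
      from A_scale[OF this, of "inverse h"] show ?thesis
        unfolding w_def[abs_def] f_def[abs_def] by simp
    qed
    have fL2: "L2_fun a b (f s)" if "s \<ge> 0" for s
      unfolding f_def using that h by (intro L2_fun_scaleR L2_fun_diff zL2) auto
    have wd: "((\<lambda>r. L2_norm a b (\<lambda>x. (w h r x - w h s x) /\<^sub>R (r - s) - f s x)) \<longlongrightarrow> 0) (at s within {0..})"
      if s: "s \<ge> 0" for s
    proof -
      \<comment> \<open>The error of the derivative splits into those of the shifted and of the
        unshifted primitive, each scaled by 1/h up to sign.\<close>
      let ?u = "\<lambda>r x. inverse h *\<^sub>R ((Z (r + h) x - Z (s + h) x) /\<^sub>R (r + h - (s + h)) - z (s + h) x)"
      let ?v = "\<lambda>r x. (- inverse h) *\<^sub>R ((Z r x - Z s x) /\<^sub>R (r - s) - z s x)"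
      have shift: "filterlim (\<lambda>r. r + h) (at (s + h) within {0..}) (at s within {0..})"
        unfolding filterlim_at
        using h by (auto simp: eventually_at_filter intro!: tendsto_intros)
      have lu: "((\<lambda>r. L2_norm a b (?u r)) \<longlongrightarrow> 0) (at s within {0..})"
      proof -
        have "((\<lambda>r. L2_norm a b (\<lambda>x. (Z (r + h) x - Z (s + h) x) /\<^sub>R (r + h - (s + h)) - z (s + h) x)) \<longlongrightarrow> 0)
            (at s within {0..})"
          by (rule filterlim_compose[OF Zd shift]) (use s h in auto)
        from tendsto_mult_right_zero[OF this, of "\<bar>inverse h\<bar>"] show ?thesis
          unfolding L2_norm_scaleR .
      qed
      have lv: "((\<lambda>r. L2_norm a b (?v r)) \<longlongrightarrow> 0) (at s within {0..})"
        using tendsto_mult_right_zero[OF Zd[OF s], of "\<bar>- inverse h\<bar>"]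
        unfolding L2_norm_scaleR .
      have "((\<lambda>r. L2_norm a b (\<lambda>x. ?u r x + ?v r x)) \<longlongrightarrow> 0) (at s within {0..})"
      proof (rule L2_norm_tendsto_0_add[where S = "{0..}", OF _ _ _ lu lv])
        fix r :: real assume "r \<in> {0..}"
        then have r: "r \<ge> 0" "r + h \<ge> 0" "s + h \<ge> 0" using s h by simp_all
        show "L2_fun a b (?u r)" by (intro L2_fun_scaleR L2_fun_diff ZL2 zL2 r)
        show "L2_fun a b (?v r)" by (intro L2_fun_scaleR L2_fun_diff ZL2 zL2 r s)
      qed (simp add: eventually_at_filter)
      moreover have "?u r x + ?v r x = (w h r x - w h s x) /\<^sub>R (r - s) - f s x" for r x
        by (simp add: w_def f_def scaleR_diff_right mult.commute)
      ultimately show ?thesis by simp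
    qed
    let ?E = "\<lambda>s. L2_form a b L (w h s) (w h s)"
    \<comment> \<open>The derivative of \<open>exp (\<alpha> * s) * ?E s\<close>;
      \<open>dissip\<close> makes it nonpositive, and the mean value theorem yields the
      decay.\<close>
    define D where "D s = \<alpha> * exp (\<alpha> * s) * ?E s + 2 * L2_form a b L (f s) (w h s) * exp (\<alpha> * s)" for s
    have "((\<lambda>s. exp (\<alpha> * s) * ?E s) has_derivative (*) (D s)) (at s within {0..t})"
      if s: "0 \<le> s" "s \<le> t" for s
    proof -
      have "(?E has_real_derivative 2 * L2_form a b L (f s) (w h s)) (at s within {0..})"
        using s h by (intro form_has_derivative wL2 fL2 wd) auto
      then have E: "(?E has_real_derivative 2 * L2_form a b L (f s) (w h s)) (at s within {0..t})"
        by (rule DERIV_subset) auto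
      have "((\<lambda>s. exp (\<alpha> * s)) has_real_derivative \<alpha> * exp (\<alpha> * s)) (at s within {0..t})"
        by (auto intro!: derivative_eq_intros)
      from DERIV_mult[OF this E] show ?thesis
        by (simp add: has_field_derivative_def D_def)
    qed
    from mvt_very_simple[OF t this] obtain s where s: "s \<in> {0..t}"
      and eq: "exp (\<alpha> * t) * ?E t - exp (\<alpha> * 0) * ?E 0 = D s * (t - 0)"
      by blast
    have "exp (\<alpha> * s) * (\<alpha> * ?E s + 2 * L2_form a b L (f s) (w h s)) \<le> 0"
      using dissip[OF wA[of s]] s by (intro mult_nonneg_nonpos) auto
    then have "D s \<le> 0" by (simp add: D_def algebra_simps)
    then have "D s * (t - 0) \<le> 0" using t by (intro mult_nonpos_nonneg) auto
    then have "exp (\<alpha> * t) * ?E t \<le> ?E 0" using eq by simp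
    then show ?thesis by (simp add: exp_minus field_simps)
  qed
  \<comment> \<open>As h tends to 0 from the right, \<open>w h s\<close> tends to \<open>z s\<close>
    since \<open>Z\<close> is differentiable in L^2. The decay estimate is uniform in h and passes
    to the limit.\<close>
  have lim: "((\<lambda>h. L2_form a b L (w h s) (w h s)) \<longlongrightarrow> L2_form a b L (z s) (z s)) (at_right 0)"
    if s: "s \<ge> 0" for s
  proof (rule form_tendsto[where S = "{0<..}"])
    have "filterlim (\<lambda>h. s + h) (at s within {0..}) (at_right 0)"
      unfolding filterlim_at using s
      by (auto simp: eventually_at_filter intro!: tendsto_eq_intros)
    from filterlim_compose[OF Zd[OF s] this]
    show "((\<lambda>h. L2_norm a b (\<lambda>x. w h s x - z s x)) \<longlongrightarrow> 0) (at_right 0)"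
      by (simp add: w_def)
  qed (use s wL2 zL2 in \<open>auto simp: eventually_at_filter\<close>)
  show ?thesis
  proof (rule tendsto_le)
    show "((\<lambda>h. exp (- \<alpha> * t) * L2_form a b L (w h 0) (w h 0)) \<longlongrightarrow>
        exp (- \<alpha> * t) * L2_form a b L (z 0) (z 0)) (at_right 0)"
      by (intro tendsto_intros lim) simp
    show "\<forall>\<^sub>F h in at_right 0. L2_form a b L (w h t) (w h t)
        \<le> exp (- \<alpha> * t) * L2_form a b L (w h 0) (w h 0)"
      using decay by (auto simp: eventually_at_filter)
  qed (use lim[OF t] in auto)
qed

end

section \<open>The density of the form of the inverse of Q\<close>

lemma AC_deriv_LINT:
  assumes "AC_deriv a b F g" "a \<le> b"
  shows "integrable (lebesgue_on {a..b}) g" "(LINT x|lebesgue_on {a..b}. g x) = F b - F a"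
proof -
  show i: "integrable (lebesgue_on {a..b}) g"
    using AC_deriv_integrable[OF assms(1)] by (simp only: integrable_lebesgue_on_Icc_iff)
  have "(LINT x|lebesgue_on {a..b}. g x) = integral {a..b} g"
    using i by (rule lebesgue_integral_eq_integral) simp
  also have "\<dots> = F b - F a"
    by (rule AC_deriv_diff[OF assms(1), symmetric]) (use assms(2) in simp_all)
  finally show "(LINT x|lebesgue_on {a..b}. g x) = F b - F a" .
qed

lemma norm_le_coercive:
  fixes A :: "real^'n^'n"
  assumes "\<eta> * (norm v)\<^sup>2 \<le> v \<bullet> (A *v v)"
  shows "\<eta> * norm v \<le> norm (A *v v)"
proof (cases "v = 0")
  case False
  have "norm v * (\<eta> * norm v) \<le> v \<bullet> (A *v v)"
    using assms by (simp add: power2_eq_square ac_simps)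
  also have "\<dots> \<le> norm v * norm (A *v v)" by (rule norm_cauchy_schwarz)
  finally show ?thesis using False by simp
qed simp

text \<open>Since \<open>Q \<zeta> = e\<close> with symmetric \<open>Q\<close>, the increments of \<open>\<zeta> \<bullet> e\<close> are
  \<open>(\<zeta> y + \<zeta> x) \<bullet> (e y - e x) - \<zeta> x \<bullet> ((Q y - Q x) *v \<zeta> y)\<close>; hence no derivative of
  \<open>\<zeta> = Q\<inverse> e\<close> is needed.\<close>

context
  fixes a b \<eta> :: real and Q Q' :: "real \<Rightarrow> real^'n^'n" and e e' \<zeta> :: "real \<Rightarrow> real^'n"
  assumes Q: "AC_deriv a b Q Q'" and e: "AC_deriv a b e e'"
    and Qsym: "\<And>x. x \<in> {a..b} \<Longrightarrow> sym_mat (Q x)"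
    and \<eta>: "\<eta> > 0" "\<And>x v. x \<in> {a..b} \<Longrightarrow> \<eta> * (norm v)\<^sup>2 \<le> v \<bullet> (Q x *v v)"
    and \<zeta>: "\<And>x. x \<in> {a..b} \<Longrightarrow> Q x *v \<zeta> x = e x"
begin

text \<open>Q y (\<zeta> y - \<zeta> x) = (e y - e x) - (Q y - Q x) \<zeta> x, and coercivity bounds
  the increment of \<open>\<zeta>\<close> by the norm of the right-hand side.\<close>

lemma continuous_on_coercive_solution: "continuous_on {a..b} \<zeta>"
  unfolding continuous_on_def
proof
  fix x assume x: "x \<in> {a..b}"
  let ?r = "\<lambda>y. norm ((e y - e x) - (Q y - Q x) *v \<zeta> x) / \<eta>"
  have "(Q \<longlongrightarrow> Q x) (at x within {a..b})" "(e \<longlongrightarrow> e x) (at x within {a..b})"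
    using AC_deriv_continuous[OF Q] AC_deriv_continuous[OF e] x by (auto simp: continuous_on_def)
  then have "(?r \<longlongrightarrow> norm ((e x - e x) - (Q x - Q x) *v \<zeta> x) / \<eta>) (at x within {a..b})"
    using \<eta>(1)
    by (intro tendsto_divide tendsto_norm tendsto_diff tendsto_const
        bounded_bilinear.tendsto[OF bounded_bilinear_matrix_vector_mult]) auto
  then have "(?r \<longlongrightarrow> 0) (at x within {a..b})" by simp
  moreover have "\<forall>\<^sub>F y in at x within {a..b}. norm (\<zeta> y - \<zeta> x) \<le> ?r y"
    unfolding eventually_at_filter
  proof (intro always_eventually allI impI)
    fix y assume "y \<noteq> x" and y: "y \<in> {a..b}"
    have "Q y *v (\<zeta> y - \<zeta> x) = (e y - e x) - (Q y - Q x) *v \<zeta> x"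
      using \<zeta>[OF x] \<zeta>[OF y] by (simp add: matrix_vector_mult_diff_distrib matrix_vector_mult_diff_rdistrib)
    with norm_le_coercive[OF \<eta>(2)[OF y], of "\<zeta> y - \<zeta> x"]
    show "norm (\<zeta> y - \<zeta> x) \<le> ?r y" using \<eta>(1) by (simp add: field_simps)
  qed
  ultimately have "((\<lambda>y. \<zeta> y - \<zeta> x) \<longlongrightarrow> 0) (at x within {a..b})"
    by (rule Lim_null_comparison[rotated])
  then show "(\<zeta> \<longlongrightarrow> \<zeta> x) (at x within {a..b})" by (simp add: LIM_zero_iff)
qed

text \<open>The density is what formal differentiation of e \<bullet> Q^-1 e gives, written in terms
  of \<zeta> = Q^-1 e.\<close>

lemma AC_deriv_inverse_form:
  "AC_deriv a b (\<lambda>x. \<zeta> x \<bullet> e x) (\<lambda>x. 2 * (\<zeta> x \<bullet> e' x) - \<zeta> x \<bullet> (Q' x *v \<zeta> x))"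
proof (rule AC_derivI_kernel)
  note c = continuous_on_coercive_solution
  \<comment> \<open>Arguments swapped, because here the vector is the continuous factor and the
    matrix the integrable one.\<close>
  have "bilinear (\<lambda>(v::real^'n) (A::real^'n^'n). A *v v)"
    using bilinear_matrix_vector_mult unfolding bilinear_def by blast
  from absolutely_integrable_continuous_mult[OF this c AC_deriv_integrable[OF Q]]
  have "(\<lambda>x. Q' x *v \<zeta> x) absolutely_integrable_on {a..b}" .
  from absolutely_integrable_continuous_mult[OF bilinear_inner c this]
    absolutely_integrable_continuous_mult[OF bilinear_inner c AC_deriv_integrable[OF e]]
  show "(\<lambda>x. 2 * (\<zeta> x \<bullet> e' x) - \<zeta> x \<bullet> (Q' x *v \<zeta> x)) absolutely_integrable_on {a..b}"
    by (intro set_integral_diff set_integrable_mult_right) auto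
  show "(\<lambda>s. norm (e' s) + norm (Q' s)) absolutely_integrable_on {a..b}"
    using absolutely_integrable_norm[OF AC_deriv_integrable[OF e]]
      absolutely_integrable_norm[OF AC_deriv_integrable[OF Q]]
    by (intro set_integral_add) (simp_all add: o_def)
  show "((\<lambda>s. (\<zeta> y + \<zeta> x) \<bullet> e' s - \<zeta> x \<bullet> (Q' s *v \<zeta> y)) has_integral (\<zeta> y \<bullet> e y - \<zeta> x \<bullet> e x)) {x..y}"
    if xy: "a \<le> x" "x \<le> y" "y \<le> b" for x y
  proof -
    have xy': "x \<in> {a..b}" "y \<in> {a..b}" using xy by auto
    have 1: "((\<lambda>s. (\<zeta> y + \<zeta> x) \<bullet> e' s) has_integral ((\<zeta> y + \<zeta> x) \<bullet> (e y - e x))) {x..y}"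
      using has_integral_linear[OF AC_deriv_has_integral[OF e xy] bounded_linear_inner_right]
      by (simp add: o_def)
    have "bounded_linear (\<lambda>A. \<zeta> x \<bullet> (A *v \<zeta> y))"
      by (intro bounded_linear_inner_right_comp
          bounded_bilinear.bounded_linear_left[OF bounded_bilinear_matrix_vector_mult])
    from has_integral_linear[OF AC_deriv_has_integral[OF Q xy] this]
    have 2: "((\<lambda>s. \<zeta> x \<bullet> (Q' s *v \<zeta> y)) has_integral (\<zeta> x \<bullet> ((Q y - Q x) *v \<zeta> y))) {x..y}"
      by (simp add: o_def)
    have "\<zeta> x \<bullet> (Q x *v \<zeta> y) = e x \<bullet> \<zeta> y"
      using sym_mat_adjoint[OF Qsym[OF xy'(1)]] \<zeta>[OF xy'(1)] by simp
    then have "(\<zeta> y + \<zeta> x) \<bullet> (e y - e x) - \<zeta> x \<bullet> ((Q y - Q x) *v \<zeta> y) = \<zeta> y \<bullet> e y - \<zeta> x \<bullet> e x"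
      using \<zeta>[OF xy'(2)]
      by (simp add: matrix_vector_mult_diff_rdistrib inner_diff_right inner_diff_left inner_add_left inner_add_right inner_commute)
    with has_integral_diff[OF 1 2] show ?thesis by simp
  qed
  fix r :: real assume "r > 0"
  have "bounded (\<zeta> ` {a..b})" by (intro compact_imp_bounded compact_continuous_image c) simp
  then obtain C where C: "C > 0" "\<And>x. x \<in> {a..b} \<Longrightarrow> norm (\<zeta> x) \<le> C"
    by (metis bounded_pos imageI)
  \<comment> \<open>There are two error terms of size r' against e' and two of size r' C against Q';
    this choice makes each pair at most \<open>r\<close>.\<close>
  define r' where "r' = r / (2 + 2 * C)"
  have r': "r' > 0" "2 * r' \<le> r" "2 * r' * C \<le> r"
    using \<open>r > 0\<close> C(1) by (auto simp: r'_def field_simps)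
  obtain d where d: "d > 0" "\<And>x y. x \<in> {a..b} \<Longrightarrow> y \<in> {a..b} \<Longrightarrow> \<bar>y - x\<bar> < d \<Longrightarrow> dist (\<zeta> y) (\<zeta> x) < r'"
    using uniformly_continuous_on_Icc[OF c r'(1)] by blast
  have "\<bar>((\<zeta> y + \<zeta> x) \<bullet> e' s - \<zeta> x \<bullet> (Q' s *v \<zeta> y)) - (2 * (\<zeta> s \<bullet> e' s) - \<zeta> s \<bullet> (Q' s *v \<zeta> s))\<bar>
      \<le> r * (norm (e' s) + norm (Q' s))"
    if s: "a \<le> x" "x \<le> s" "s \<le> y" "y \<le> b" "y - x < d" for x y s
  proof -
    have n: "norm (\<zeta> y - \<zeta> s) \<le> r'" "norm (\<zeta> x - \<zeta> s) \<le> r'" "norm (\<zeta> y) \<le> C" "norm (\<zeta> s) \<le> C"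
      using d(2)[of s y] d(2)[of s x] C(2)[of s] C(2)[of y] s by (auto simp: dist_norm)
    have "\<bar>(\<zeta> y - \<zeta> s) \<bullet> e' s\<bar> \<le> r' * norm (e' s)" "\<bar>(\<zeta> x - \<zeta> s) \<bullet> e' s\<bar> \<le> r' * norm (e' s)"
      using n Cauchy_Schwarz_ineq2[of "\<zeta> y - \<zeta> s" "e' s"] Cauchy_Schwarz_ineq2[of "\<zeta> x - \<zeta> s" "e' s"]
      by (meson mult_right_mono norm_ge_zero order_trans)+
    moreover have "2 * r' * norm (e' s) \<le> r * norm (e' s)" using r'(2) by (rule mult_right_mono) simp
    moreover have "\<bar>(\<zeta> x - \<zeta> s) \<bullet> (Q' s *v \<zeta> y)\<bar> \<le> norm (Q' s) * (r' * C)"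
      using abs_matrix_form_le[of "\<zeta> x - \<zeta> s" "Q' s" "\<zeta> y"] n r'(1)
      by (elim order_trans) (intro mult_left_mono mult_mono, auto)
    moreover have "\<bar>\<zeta> s \<bullet> (Q' s *v (\<zeta> y - \<zeta> s))\<bar> \<le> norm (Q' s) * (C * r')"
      using abs_matrix_form_le[of "\<zeta> s" "Q' s" "\<zeta> y - \<zeta> s"] n C(1)
      by (elim order_trans) (intro mult_left_mono mult_mono, auto)
    moreover have "norm (Q' s) * (2 * r' * C) \<le> norm (Q' s) * r" using r'(3) by (rule mult_left_mono) simp
    moreover have "((\<zeta> y + \<zeta> x) \<bullet> e' s - \<zeta> x \<bullet> (Q' s *v \<zeta> y)) - (2 * (\<zeta> s \<bullet> e' s) - \<zeta> s \<bullet> (Q' s *v \<zeta> s))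
      = (\<zeta> y - \<zeta> s) \<bullet> e' s + (\<zeta> x - \<zeta> s) \<bullet> e' s - (\<zeta> x - \<zeta> s) \<bullet> (Q' s *v \<zeta> y) - \<zeta> s \<bullet> (Q' s *v (\<zeta> y - \<zeta> s))"
      by (simp add: inner_diff_left inner_diff_right inner_add_left matrix_vector_mult_diff_distrib)
    ultimately show ?thesis by (simp add: algebra_simps abs_le_iff)
  qed
  with d(1) show "\<exists>d>0. \<forall>x y s. a \<le> x \<longrightarrow> x \<le> s \<longrightarrow> s \<le> y \<longrightarrow> y \<le> b \<longrightarrow> y - x < d \<longrightarrow>
      \<bar>((\<zeta> y + \<zeta> x) \<bullet> e' s - \<zeta> x \<bullet> (Q' s *v \<zeta> y)) - (2 * (\<zeta> s \<bullet> e' s) - \<zeta> s \<bullet> (Q' s *v \<zeta> s))\<bar>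
      \<le> r * (norm (e' s) + norm (Q' s))" by blast
qed

end

text \<open>Continuous functions, hence by dominated convergence the truncation of \<open>g\<close> itself, integrate
  to zero against \<open>g\<close>.\<close>

lemma AC_deriv_const_imp_AE_0:
  fixes g :: "real \<Rightarrow> real"
  assumes g: "AC_deriv a b (\<lambda>_. 0) g" and "a \<le> b"
  shows "AE x in lebesgue_on {a..b}. g x = 0"
proof -
  note gi = AC_deriv_integrable[OF g]
  have test: "(LINT x|lebesgue_on {a..b}. \<phi> x * g x) = 0"
    if c: "continuous_on {a..b} \<phi>" for \<phi> :: "real \<Rightarrow> real"
  proof -
    \<comment> \<open>Freezing \<open>\<phi>\<close> at the left endpoint gives a kernel with zero
      integral, because the primitive of \<open>g\<close> is constant.\<close>
    have "AC_deriv a b (\<lambda>_. 0) (\<lambda>x. \<phi> x * g x)"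
    proof (rule AC_derivI_kernel)
      show "(\<lambda>x. \<phi> x * g x) absolutely_integrable_on {a..b}"
        by (rule absolutely_integrable_continuous_mult[OF bilinear_times c gi])
      show "(\<lambda>s. \<bar>g s\<bar>) absolutely_integrable_on {a..b}"
        using absolutely_integrable_norm[OF gi] by (simp add: o_def)
      show "((\<lambda>s. \<phi> x * g s) has_integral 0 - 0) {x..y}" if "a \<le> x" "x \<le> y" "y \<le> b" for x y
        using has_integral_mult_right[OF AC_deriv_has_integral[OF g that], of "\<phi> x"] by simp
      fix e :: real assume "e > 0"
      obtain d where d: "d > 0" "\<And>x y. x \<in> {a..b} \<Longrightarrow> y \<in> {a..b} \<Longrightarrow> \<bar>y - x\<bar> < d \<Longrightarrow> dist (\<phi> y) (\<phi> x) < e"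
        using uniformly_continuous_on_Icc[OF c \<open>e > 0\<close>] by blast
      have "\<bar>\<phi> x * g s - \<phi> s * g s\<bar> \<le> e * \<bar>g s\<bar>"
        if "a \<le> x" "x \<le> s" "s \<le> y" "y \<le> b" "y - x < d" for x y s
      proof -
        have "\<bar>\<phi> x - \<phi> s\<bar> \<le> e" using d(2)[of s x] that by (auto simp: dist_real_def)
        then have "\<bar>\<phi> x - \<phi> s\<bar> * \<bar>g s\<bar> \<le> e * \<bar>g s\<bar>" by (rule mult_right_mono) simp
        then show ?thesis by (simp add: left_diff_distrib flip: abs_mult)
      qed
      with d(1) show "\<exists>d>0. \<forall>x y s. a \<le> x \<longrightarrow> x \<le> s \<longrightarrow> s \<le> y \<longrightarrow> y \<le> b \<longrightarrow> y - x < d \<longrightarrow>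
        \<bar>\<phi> x * g s - \<phi> s * g s\<bar> \<le> e * \<bar>g s\<bar>" by blast
    qed
    from AC_deriv_LINT(2)[OF this \<open>a \<le> b\<close>] show ?thesis by simp
  qed
  have int: "integrable (lebesgue_on {a..b}) g"
    using gi by (simp only: integrable_lebesgue_on_Icc_iff)
  then have "g measurable_on {a..b}"
    by (intro iffD2[OF measurable_on_iff_borel_measurable]) auto
  then obtain N h where N: "negligible N" and hc: "\<And>n. continuous_on UNIV (h n)"
    and hlim: "\<And>x. x \<notin> N \<Longrightarrow> (\<lambda>n. h n x) \<longlonglongrightarrow> (if x \<in> {a..b} then g x else 0)"
    unfolding measurable_on_def by blast
  \<comment> \<open>Clipping to [-1, 1] makes \<open>\<bar>g x\<bar>\<close> a dominating function,
    while \<open>cl r * r\<close> is nonnegative and vanishes only at \<open>r = 0\<close>.\<close>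
  define cl :: "real \<Rightarrow> real" where "cl r = max (-1) (min 1 r)" for r
  have clc: "continuous_on UNIV cl" unfolding cl_def by (intro continuous_intros)
  have "N \<in> null_sets lebesgue" using N by (simp add: negligible_iff_null_sets)
  then have "AE x in lebesgue. x \<notin> N" by (rule AE_not_in)
  then have "AE x in lebesgue_on {a..b}. x \<notin> N" by (auto simp: AE_restrict_space_iff)
  then have lim: "AE x in lebesgue_on {a..b}. (\<lambda>n. cl (h n x) * g x) \<longlonglongrightarrow> cl (g x) * g x"
    using AE_space
  proof eventually_elim
    case (elim x)
    then have "(\<lambda>n. h n x) \<longlonglongrightarrow> g x" using hlim[of x] by simp
    then have "(\<lambda>n. cl (h n x)) \<longlonglongrightarrow> cl (g x)"
      unfolding cl_def by (intro tendsto_intros)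
    then show ?case by (intro tendsto_intros)
  qed
  have gm: "g \<in> borel_measurable (lebesgue_on {a..b})" using int by auto
  have clm: "cl \<in> borel_measurable borel" using clc by (rule borel_measurable_continuous_onI)
  have m: "(\<lambda>x. cl (g x) * g x) \<in> borel_measurable (lebesgue_on {a..b})"
    by (intro borel_measurable_times measurable_compose[OF _ clm] gm)
  have cln: "continuous_on {a..b} (\<lambda>x. cl (h n x))" for n
    using continuous_on_compose2[OF clc hc] continuous_on_subset by blast
  have mn: "(\<lambda>x. cl (h n x) * g x) \<in> borel_measurable (lebesgue_on {a..b})" for n
    by (intro borel_measurable_times continuous_on_measurable_Icc cln gm)
  have cl1: "\<bar>cl r\<bar> \<le> 1" for r by (auto simp: cl_def)
  have bnd: "norm (cl r * s) \<le> \<bar>s\<bar>" for r s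
    using mult_right_mono[OF cl1, of "\<bar>s\<bar>" r] by (simp add: abs_mult)
  have abs_int: "integrable (lebesgue_on {a..b}) (\<lambda>x. \<bar>g x\<bar>)" using int by (rule integrable_abs)
  have "(\<lambda>n. LINT x|lebesgue_on {a..b}. cl (h n x) * g x) \<longlonglongrightarrow> (LINT x|lebesgue_on {a..b}. cl (g x) * g x)"
    by (rule integral_dominated_convergence[OF m mn abs_int lim]) (use bnd in auto)
  then have zero: "(LINT x|lebesgue_on {a..b}. cl (g x) * g x) = 0"
    using test[OF cln] by (simp add: LIMSEQ_const_iff)
  have pos: "cl r * r \<ge> 0" "cl r * r = 0 \<longleftrightarrow> r = 0" for r
    by (auto simp: cl_def min_def max_def zero_le_mult_iff mult_le_0_iff)
  have "integrable (lebesgue_on {a..b}) (\<lambda>x. cl (g x) * g x)"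
    by (rule Bochner_Integration.integrable_bound[OF int m]) (use bnd in auto)
  from integral_nonneg_eq_0_iff_AE[OF this] zero pos
  show ?thesis by simp
qed

text \<open>The entry differences \<open>Q x $ i $ j - Q x $ j $ i\<close> vanish identically, so
  their densities vanish almost everywhere. This gives symmetry of \<open>B_mat\<close> almost
  everywhere, without which \<open>max_eig\<close> says nothing about its form.\<close>

lemma AE_sym_mat_AC_deriv:
  fixes Q Q' :: "real \<Rightarrow> real^'n^'n"
  assumes Q: "AC_deriv a b Q Q'" and "a \<le> b" and sym: "\<And>x. x \<in> {a..b} \<Longrightarrow> sym_mat (Q x)"
  shows "AE x in lebesgue_on {a..b}. sym_mat (Q' x)"
proof -
  have "AE x in lebesgue_on {a..b}. Q' x $ i $ j - Q' x $ j $ i = 0" for i j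
  proof (rule AC_deriv_const_imp_AE_0[OF _ \<open>a \<le> b\<close>])
    have "bounded_linear (\<lambda>A::real^'n^'n. A $ i $ j - A $ j $ i)"
      by (intro bounded_linear_sub bounded_linear_vec_nth[THEN bounded_linear_compose, unfolded o_def]
          bounded_linear_vec_nth)
    from AC_deriv_linear[OF this Q]
    have *: "AC_deriv a b (\<lambda>x. Q x $ i $ j - Q x $ j $ i) (\<lambda>x. Q' x $ i $ j - Q' x $ j $ i)" .
    have z: "Q x $ i $ j - Q x $ j $ i = 0" if "x \<in> {a..b}" for x
    proof -
      have "transpose (Q x) $ i $ j = Q x $ i $ j" using sym[OF that] by (simp add: sym_mat_def)
      then show ?thesis by (simp add: transpose_def)
    qed
    have "0 = 0 + integral {a..x} (\<lambda>x. Q' x $ i $ j - Q' x $ j $ i)" if "x \<in> {a..b}" for x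
      using AC_deriv_eq[OF * that] z[OF that] z[of a] \<open>a \<le> b\<close> by simp
    then show "AC_deriv a b (\<lambda>_. 0) (\<lambda>x. Q' x $ i $ j - Q' x $ j $ i)"
      unfolding AC_deriv_def using AC_deriv_integrable[OF *] by blast
  qed
  then have "AE x in lebesgue_on {a..b}. \<forall>i j. Q' x $ i $ j - Q' x $ j $ i = 0"
    by (simp add: AE_all_countable)
  then show ?thesis
    by eventually_elim (simp add: sym_mat_def transpose_def vec_eq_iff)
qed

section \<open>Dissipation\<close>

lemma H1_deriv_L2: "H1_deriv a b w w' \<Longrightarrow> L2_fun a b w'"
  unfolding H1_deriv_def by (rule conjunct1)

lemma H1_deriv_eq:
  "H1_deriv a b w w' \<Longrightarrow> x \<in> {a..b} \<Longrightarrow> w x = w a + (LINT s|lebesgue_on {a..x}. w' s)"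
  unfolding H1_deriv_def by (drule conjunct2) (rule bspec)

lemma H1_deriv_diff:
  assumes u: "H1_deriv a b u u'" and v: "H1_deriv a b v v'"
  shows "H1_deriv a b (\<lambda>x. u x - v x) (\<lambda>x. u' x - v' x)"
  unfolding H1_deriv_def
proof (intro conjI ballI)
  show "L2_fun a b (\<lambda>x. u' x - v' x)"
    by (intro L2_fun_diff H1_deriv_L2[OF u] H1_deriv_L2[OF v])
  fix x assume x: "x \<in> {a..b}"
  have i: "integrable (lebesgue_on {a..x}) w'" if w: "H1_deriv a b w w'" for w w' :: "real \<Rightarrow> 'a"
    unfolding integrable_lebesgue_on_Icc_iff
    by (rule absolutely_integrable_on_Icc_subset[OF AC_deriv_integrable[OF H1_deriv_imp_AC_deriv[OF w]]])
      (use x in auto)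
  have ux: "u x = u a + (LINT s|lebesgue_on {a..x}. u' s)" and vx: "v x = v a + (LINT s|lebesgue_on {a..x}. v' s)"
    by (rule H1_deriv_eq[OF u x], rule H1_deriv_eq[OF v x])
  have "u x - v x = (u a + (LINT s|lebesgue_on {a..x}. u' s)) - (v a + (LINT s|lebesgue_on {a..x}. v' s))"
    by (rule arg_cong2[where f = minus, OF ux vx])
  also have "\<dots> = u a - v a + (LINT s|lebesgue_on {a..x}. u' s - v' s)"
    unfolding Bochner_Integration.integral_diff[OF i[OF u] i[OF v]] by (rule add_diff_add)
  finally show "u x - v x = u a - v a + (LINT s|lebesgue_on {a..x}. u' s - v' s)" .
qed

lemma H1_deriv_scaleR:
  assumes u: "H1_deriv a b u u'"
  shows "H1_deriv a b (\<lambda>x. r *\<^sub>R u x) (\<lambda>x. r *\<^sub>R u' x)"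
  unfolding H1_deriv_def
proof (intro conjI ballI)
  show "L2_fun a b (\<lambda>x. r *\<^sub>R u' x)"
    by (intro L2_fun_scaleR H1_deriv_L2[OF u])
  fix x assume x: "x \<in> {a..b}"
  have "u x = u a + (LINT s|lebesgue_on {a..x}. u' s)"
    by (rule H1_deriv_eq[OF u x])
  then have "r *\<^sub>R u x = r *\<^sub>R (u a + (LINT s|lebesgue_on {a..x}. u' s))" by (rule arg_cong)
  then show "r *\<^sub>R u x = r *\<^sub>R u a + (LINT s|lebesgue_on {a..x}. r *\<^sub>R u' s)"
    by (simp only: integral_scaleR_right scaleR_right_distrib)
qed

lemma phs_operatorE:
  assumes "phs_operator a b P1 P0 G0 Q W1 W1t W2 K z f"
  obtains e e' where "L2_fun a b z" "L2_fun a b f" "H1_deriv a b e e'"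
    "AE x in lebesgue_on {a..b}. e x = Q x *v z x"
    "W2 *v e a = 0" "W1 *v e b + K *v (W1t *v e b) = 0"
    "AE x in lebesgue_on {a..b}. f x = P1 *v e' x + (P0 - G0) *v e x"
  using assms unfolding phs_operator_def by (elim conjE exE)

text \<open>Linearity of the operator graph, which puts difference quotients of the primitive of a
  mild solution into the domain.\<close>

lemma phs_operator_diff:
  assumes "phs_operator a b P1 P0 G0 Q W1 W1t W2 K u f" "phs_operator a b P1 P0 G0 Q W1 W1t W2 K v g"
  shows "phs_operator a b P1 P0 G0 Q W1 W1t W2 K (\<lambda>x. u x - v x) (\<lambda>x. f x - g x)"
proof -
  obtain d d' where d: "H1_deriv a b d d'" "AE x in lebesgue_on {a..b}. d x = Q x *v u x"
    "W2 *v d a = 0" "W1 *v d b + K *v (W1t *v d b) = 0"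
    "AE x in lebesgue_on {a..b}. f x = P1 *v d' x + (P0 - G0) *v d x"
    using assms(1) unfolding phs_operator_def by blast
  obtain e e' where e: "H1_deriv a b e e'" "AE x in lebesgue_on {a..b}. e x = Q x *v v x"
    "W2 *v e a = 0" "W1 *v e b + K *v (W1t *v e b) = 0"
    "AE x in lebesgue_on {a..b}. g x = P1 *v e' x + (P0 - G0) *v e x"
    using assms(2) unfolding phs_operator_def by blast
  have "AE x in lebesgue_on {a..b}. d x - e x = Q x *v (u x - v x)"
    using d(2) e(2) by eventually_elim (simp add: matrix_vector_mult_diff_distrib)
  moreover have "AE x in lebesgue_on {a..b}. f x - g x = P1 *v (d' x - e' x) + (P0 - G0) *v (d x - e x)"
    using d(5) e(5) by eventually_elim (simp add: matrix_vector_mult_diff_distrib)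
  moreover have "W2 *v (d a - e a) = 0" using d(3) e(3) by (simp add: matrix_vector_mult_diff_distrib)
  moreover have "W1 *v (d b - e b) + K *v (W1t *v (d b - e b))
      = (W1 *v d b + K *v (W1t *v d b)) - (W1 *v e b + K *v (W1t *v e b))"
    by (simp add: matrix_vector_mult_diff_distrib)
  then have "W1 *v (d b - e b) + K *v (W1t *v (d b - e b)) = 0" unfolding d(4) e(4) by simp
  moreover have "L2_fun a b (\<lambda>x. u x - v x)" "L2_fun a b (\<lambda>x. f x - g x)"
    using assms unfolding phs_operator_def by (blast intro: L2_fun_diff)+
  ultimately show ?thesis
    unfolding phs_operator_def using H1_deriv_diff[OF d(1) e(1)] by blast
qed

lemma phs_operator_scaleR:
  assumes "phs_operator a b P1 P0 G0 Q W1 W1t W2 K u f"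
  shows "phs_operator a b P1 P0 G0 Q W1 W1t W2 K (\<lambda>x. r *\<^sub>R u x) (\<lambda>x. r *\<^sub>R f x)"
proof -
  obtain d d' where d: "H1_deriv a b d d'" "AE x in lebesgue_on {a..b}. d x = Q x *v u x"
    "W2 *v d a = 0" "W1 *v d b + K *v (W1t *v d b) = 0"
    "AE x in lebesgue_on {a..b}. f x = P1 *v d' x + (P0 - G0) *v d x"
    using assms(1) unfolding phs_operator_def by blast
  have "AE x in lebesgue_on {a..b}. r *\<^sub>R d x = Q x *v (r *\<^sub>R u x)"
    using d(2) by eventually_elim (simp add: matrix_vector_mult_scaleR)
  moreover have "AE x in lebesgue_on {a..b}. r *\<^sub>R f x = P1 *v (r *\<^sub>R d' x) + (P0 - G0) *v (r *\<^sub>R d x)"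
    using d(5) by eventually_elim (simp add: matrix_vector_mult_scaleR scaleR_right_distrib)
  moreover have "W2 *v (r *\<^sub>R d a) = 0" using d(3) by (simp add: matrix_vector_mult_scaleR)
  moreover have "W1 *v (r *\<^sub>R d b) + K *v (W1t *v (r *\<^sub>R d b)) = r *\<^sub>R (W1 *v d b + K *v (W1t *v d b))"
    by (simp add: matrix_vector_mult_scaleR scaleR_right_distrib)
  then have "W1 *v (r *\<^sub>R d b) + K *v (W1t *v (r *\<^sub>R d b)) = 0" unfolding d(4) by simp
  moreover have "L2_fun a b (\<lambda>x. r *\<^sub>R u x)" "L2_fun a b (\<lambda>x. r *\<^sub>R f x)"
    using assms unfolding phs_operator_def by (blast intro: L2_fun_scaleR)+
  ultimately show ?thesis
    unfolding phs_operator_def using H1_deriv_scaleR[OF d(1)] by blast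
qed

lemma stack_mult_vec: "stack A B *v x = (\<chi> i. case i of Inl j \<Rightarrow> (A *v x) $ j | Inr j \<Rightarrow> (B *v x) $ j)"
  by (simp add: vec_eq_iff matrix_vector_mult_def stack_def split: sum.split)

text \<open>Turns the two factorisations of \<open>P1\<close> into boundary pairings: e \<bullet> P1
  e is twice input times output at b, and contains the factor \<open>W2 *v e a\<close> at a.\<close>

lemma symmetrised_product_form:
  fixes A B :: "real^'n^'k"
  shows "v \<bullet> ((transpose A ** B + transpose B ** A) *v v) = 2 * ((A *v v) \<bullet> (B *v v))"
proof -
  have "v \<bullet> (transpose A *v w) = (A *v v) \<bullet> w" for A :: "real^'n^'k" and w
    by (metis transpose_adjoint transpose_transpose)
  then show ?thesis
    by (simp add: matrix_vector_mult_add_rdistrib inner_add_right inner_commute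
        flip: matrix_vector_mul_assoc)
qed

section \<open>The system: pointwise identities and the Lyapunov estimate\<close>

locale port_Hamiltonian =
  fixes a b :: real
    and P1 P0 G0 :: "real^'n^'n"
    and Q Q' :: "real \<Rightarrow> real^'n^'n"
    and W1 W1t W2 W2t :: "real^'n^'k"
    and K :: "real^'k^'k"
  assumes a_less_b: "a < b"
    and card: "CARD('n) = 2 * CARD('k)"
    and P1_sym: "sym_mat P1" and P1_inv: "invertible P1"
    and P0_skew: "skew_mat P0"
    and G0_psd: "pos_semidef G0"
    and Q_H1: "H1_deriv a b Q Q'"
    and Q_pos: "\<And>x. x \<in> {a..b} \<Longrightarrow> pos_def (Q x)"
    and rank_W: "rank (stack W1 W1t) = CARD('n)"
    and W1_P1: "transpose W1 ** W1t + transpose W1t ** W1 = P1"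
    and W2_P1: "P1 = - (transpose W2 ** W2t + transpose W2t ** W2)"
    and K_pos: "pos_def K"
begin

abbreviation P1i where "P1i \<equiv> matrix_inv P1"
abbreviation B where "B \<equiv> B_mat P1 P0 G0 Q Q'"
abbreviation Psi where "Psi \<equiv> Psi_mat W1 W1t K Q"
abbreviation op where "op \<equiv> phs_operator a b P1 P0 G0 Q W1 W1t W2 K"

lemma a_le_b: "a \<le> b" using a_less_b by simp

lemmas Q_AC = H1_deriv_imp_AC_deriv[OF Q_H1]
lemmas Q_cont = AC_deriv_continuous[OF Q_AC]

lemma Q_sym: "x \<in> {a..b} \<Longrightarrow> sym_mat (Q x)"
  by (rule pos_def_sym[OF Q_pos])

lemma P1i: "P1 ** P1i = mat 1" "P1i ** P1 = mat 1"
  using P1_inv matrix_inv_works unfolding invertible_def by blast+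

lemma P1i_sym: "sym_mat P1i"
  by (rule sym_mat_inverse[OF P1_sym P1i])

lemma Q_inv_vec: "x \<in> {a..b} \<Longrightarrow> Q x *v (matrix_inv (Q x) *v v) = v"
  "x \<in> {a..b} \<Longrightarrow> matrix_inv (Q x) *v (Q x *v v) = v"
  using pos_def_matrix_inv[OF Q_pos] by (simp_all add: matrix_vector_mul_assoc)

lemma Q_inv_sym: "x \<in> {a..b} \<Longrightarrow> sym_mat (matrix_inv (Q x))"
  using Q_sym pos_def_matrix_inv[OF Q_pos] sym_mat_inverse by blast

text \<open>The form is continuous and positive on the compact product of \<open>{a..b}\<close> with
  the unit sphere, so its minimum there is a uniform constant.\<close>

lemma Q_coercive: "\<exists>\<eta>>0. \<forall>x\<in>{a..b}. \<forall>v. \<eta> * (norm v)\<^sup>2 \<le> v \<bullet> (Q x *v v)"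
proof -
  let ?S = "{a..b} \<times> sphere (0::real^'n) 1"
  have compact: "compact ?S" by (intro compact_Times compact_Icc compact_sphere)
  obtain u :: "real^'n" where "norm u = 1" using norm_axis_1 by blast
  then have "(a, u) \<in> ?S" using a_le_b by simp
  then have nonempty: "?S \<noteq> {}" by blast
  have 1: "continuous_on ?S (\<lambda>p. Q (fst p))"
    by (rule continuous_on_compose2[OF Q_cont continuous_on_fst[OF continuous_on_id]]) auto
  have 2: "continuous_on ?S snd" by (rule continuous_on_snd[OF continuous_on_id])
  obtain p where p: "p \<in> ?S"
    and le: "\<forall>q\<in>?S. snd p \<bullet> (Q (fst p) *v snd p) \<le> snd q \<bullet> (Q (fst q) *v snd q)"
    using continuous_attains_inf[OF compact nonempty continuous_on_inner[OF 2
        bounded_bilinear.continuous_on[OF bounded_bilinear_matrix_vector_mult 1 2]]] by blast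
  define \<eta> where "\<eta> = snd p \<bullet> (Q (fst p) *v snd p)"
  have "fst p \<in> {a..b}" "snd p \<noteq> 0" using p by auto
  then have "\<eta> > 0" using Q_pos[of "fst p"] unfolding \<eta>_def pos_def_def by blast
  moreover have "\<eta> * (norm v)\<^sup>2 \<le> v \<bullet> (Q x *v v)" if x: "x \<in> {a..b}" for x v
  proof (cases "v = 0")
    case False
    have "\<eta> \<le> (v /\<^sub>R norm v) \<bullet> (Q x *v (v /\<^sub>R norm v))"
      using bspec[OF le, of "(x, v /\<^sub>R norm v)"] x False by (simp add: \<eta>_def)
    then show ?thesis using False by (simp add: matrix_vector_mult_scaleR field_simps power2_eq_square)
  qed simp
  ultimately show ?thesis by blast
qed

lemma Q_form_nonneg: "x \<in> {a..b} \<Longrightarrow> 0 \<le> v \<bullet> (Q x *v v)"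
  using Q_pos[of x] by (cases "v = 0") (auto simp: pos_def_def less_imp_le)

lemma Q_bounded: "\<exists>c>0. \<forall>x\<in>{a..b}. norm (Q x) \<le> c"
proof -
  have "bounded (Q ` {a..b})" by (intro compact_imp_bounded compact_continuous_image Q_cont) simp
  then show ?thesis by (metis bounded_pos imageI)
qed

text \<open>As \<open>P0\<close> is skew and \<open>G0\<close> symmetric, the transpose of
  \<open>P0 + G0\<close> is \<open>- (P0 - G0)\<close>; hence the two product terms of
  \<open>B\<close> contribute equally to the form.\<close>

lemma B_form:
  assumes x: "x \<in> {a..b}"
  shows "v \<bullet> (B x *v v) = v \<bullet> (Q' x *v v) + 2 * ((P1i *v v) \<bullet> ((P0 - G0) *v (Q x *v v)))"
proof -
  have "(P0 *v w) \<bullet> u = - (w \<bullet> (P0 *v u))" "(G0 *v w) \<bullet> u = w \<bullet> (G0 *v u)" for u w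
    using P0_skew G0_psd transpose_adjoint[of w P0 u] transpose_adjoint[of w G0 u]
    by (simp_all add: skew_mat_def pos_semidef_def sym_mat_def uminus_matrix_vector_mult)
  then have adj: "w \<bullet> ((P0 + G0) *v u) = - (((P0 - G0) *v w) \<bullet> u)" for u w
    by (simp add: matrix_vector_mult_add_rdistrib matrix_vector_mult_diff_rdistrib inner_add_right
        inner_diff_left)
  have "v \<bullet> ((Q x ** (P0 + G0) ** P1i) *v v) = (Q x *v v) \<bullet> ((P0 + G0) *v (P1i *v v))"
    using sym_mat_adjoint[OF Q_sym[OF x], of v] by (simp flip: matrix_vector_mul_assoc)
  also have "\<dots> = - (((P0 - G0) *v (Q x *v v)) \<bullet> (P1i *v v))" by (rule adj)
  finally have 1: "v \<bullet> ((Q x ** (P0 + G0) ** P1i) *v v) = - ((P1i *v v) \<bullet> ((P0 - G0) *v (Q x *v v)))"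
    by (simp add: inner_commute)
  have 2: "v \<bullet> ((P1i ** (P0 - G0) ** Q x) *v v) = (P1i *v v) \<bullet> ((P0 - G0) *v (Q x *v v))"
    using sym_mat_adjoint[OF P1i_sym, of v] by (simp flip: matrix_vector_mul_assoc)
  show ?thesis
    unfolding B_mat_def matrix_vector_mult_add_rdistrib matrix_vector_mult_diff_rdistrib
      inner_add_right inner_diff_right 1 2 by simp
qed

lemma W_inv: "stack W1 W1t ** matrix_inv (stack W1 W1t) = mat 1"
  "matrix_inv (stack W1 W1t) ** stack W1 W1t = mat 1"
  using matrix_inv_full_rank[OF rank_W] card by simp_all

text \<open>The feedback condition at b says stack W1 W1t e(b) = stack (- K) 1 y. This matrix
  recovers the boundary value e(b) from the output y.\<close>

definition output_lift :: "real^'k^'n" where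
  "output_lift = matrix_inv (stack W1 W1t) ** stack (- K) (mat 1)"

lemma output_lift_eq:
  assumes "W1 *v v + K *v (W1t *v v) = 0"
  shows "output_lift *v (W1t *v v) = v"
proof -
  have "W1 *v v = - K *v (W1t *v v)"
    using assms by (simp add: uminus_matrix_vector_mult eq_neg_iff_add_eq_0)
  then have "stack (- K) (mat 1) *v (W1t *v v) = stack W1 W1t *v v"
    by (simp only: stack_mult_vec matrix_vector_mul_lid)
  then show ?thesis
    unfolding output_lift_def by (metis W_inv(2) matrix_vector_mul_assoc matrix_vector_mul_lid)
qed

text \<open>The lower block of \<open>stack (- K) (mat 1)\<close> is the identity. Strict positivity
  of \<open>Psi\<close> rests on this.\<close>

lemma output_lift_inj: "output_lift *v y = 0 \<Longrightarrow> y = 0"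
proof -
  assume "output_lift *v y = 0"
  then have "stack W1 W1t *v (output_lift *v y) = 0" by simp
  then have "stack (- K) (mat 1) *v y = 0"
    unfolding output_lift_def by (metis W_inv(1) matrix_vector_mul_assoc matrix_vector_mul_lid)
  then have "(stack (- K) (mat 1) *v y) $ Inr j = 0" for j by simp
  then show "y = 0" by (simp add: stack_mult_vec vec_eq_iff)
qed

lemma Psi_eq: "Psi x = transpose output_lift ** matrix_inv (Q x) ** output_lift"
  unfolding Psi_mat_def output_lift_def matrix_transpose_mul matrix_mul_assoc ..

text \<open>With e(b) = output_lift y this form at b is e(b) \<bullet> Q(b)^-1 e(b), the boundary
  term left by the multiplier.\<close>

lemma Psi_form: "y \<bullet> (Psi x *v y) = (output_lift *v y) \<bullet> (matrix_inv (Q x) *v (output_lift *v y))"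
  unfolding Psi_eq matrix_vector_mul_assoc[symmetric] transpose_adjoint[of y] transpose_transpose ..

lemma Psi_sym: "x \<in> {a..b} \<Longrightarrow> sym_mat (Psi x)"
  using Q_inv_sym[of x] unfolding sym_mat_def Psi_eq
  by (simp add: matrix_transpose_mul matrix_mul_assoc)

lemma lyapunov_form:
  assumes m: "continuous_on {a..b} m"
  obtains c where "L2_sym_form a b c (\<lambda>x. Q x + (\<epsilon> * m x) *\<^sub>R P1i)"
proof -
  let ?L = "\<lambda>x. Q x + (\<epsilon> * m x) *\<^sub>R P1i"
  have cont: "continuous_on {a..b} ?L" by (intro continuous_intros Q_cont m)
  then have "bounded (?L ` {a..b})" by (intro compact_imp_bounded compact_continuous_image compact_Icc)
  then obtain c where c: "c > 0" "\<forall>A\<in>?L ` {a..b}. norm A \<le> c" unfolding bounded_pos by blast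
  have "L2_sym_form a b c ?L"
  proof
    show "?L \<in> borel_measurable (lebesgue_on {a..b})" by (rule continuous_on_measurable_Icc[OF cont])
    show "sym_mat (?L x)" if "x \<in> {a..b}" for x
      using Q_sym[OF that] P1i_sym by (simp add: sym_mat_def transpose_add transpose_scalar)
    show "norm (?L x) \<le> c" if "x \<in> {a..b}" for x
      using c(2) that by (rule bspec[OF _ imageI])
    show "0 \<le> c" using c(1) by simp
  qed
  then show thesis by (rule that)
qed

text \<open>Pointwise, the integrand is half the density of e \<bullet> P1 e, plus \<epsilon>/2
  times the density of m \<zeta> \<bullet> e, minus \<epsilon>/2 times (m' Q - m B) evaluated at
  \<zeta>, minus e \<bullet> G0 e. The hypothesis \<open>rate\<close> trades the third term for the
  energy density; \<open>bc\<close> lets the damping by K absorb the boundary term at b.\<close>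

lemma dissipation:
  fixes m m' :: "real \<Rightarrow> real"
  assumes m: "AC_deriv a b m m'" and m_nonneg: "\<And>x. x \<in> {a..b} \<Longrightarrow> 0 \<le> m x" and \<epsilon>: "0 \<le> \<epsilon>"
    and rate: "AE x in lebesgue_on {a..b}. \<forall>v.
      m x * (v \<bullet> (B x *v v)) + \<delta> * (v \<bullet> (Q x *v v)) \<le> m' x * (v \<bullet> (Q x *v v))"
    and bc: "\<And>y. \<epsilon> / 2 * (m b * (y \<bullet> (Psi b *v y))) \<le> y \<bullet> (K *v y)"
    and op: "op z f"
  shows "L2_form a b (\<lambda>x. Q x + (\<epsilon> * m x) *\<^sub>R P1i) f z \<le> - (\<epsilon> * \<delta> / 2) * L2_form a b Q z z"
proof -
  obtain e e' where e_H1: "H1_deriv a b e e'" and ez: "AE x in lebesgue_on {a..b}. e x = Q x *v z x"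
    and bca: "W2 *v e a = 0" and bcb: "W1 *v e b + K *v (W1t *v e b) = 0"
    and f_eq: "AE x in lebesgue_on {a..b}. f x = P1 *v e' x + (P0 - G0) *v e x"
    and L2: "L2_fun a b z" "L2_fun a b f"
    using op by (rule phs_operatorE)
  note e = H1_deriv_imp_AC_deriv[OF e_H1]
  \<comment> \<open>The continuous representative of \<open>z\<close>; unlike \<open>z\<close> it
    has boundary values.\<close>
  define \<zeta> where "\<zeta> x = matrix_inv (Q x) *v e x" for x
  have Q\<zeta>: "Q x *v \<zeta> x = e x" if "x \<in> {a..b}" for x
    unfolding \<zeta>_def by (rule Q_inv_vec(1)[OF that])
  have z\<zeta>: "AE x in lebesgue_on {a..b}. z x = \<zeta> x"
    using ez AE_space by eventually_elim (simp add: \<zeta>_def Q_inv_vec)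
  obtain \<eta> where \<eta>: "\<eta> > 0" "\<And>x v. x \<in> {a..b} \<Longrightarrow> \<eta> * (norm v)\<^sup>2 \<le> v \<bullet> (Q x *v v)"
    using Q_coercive by blast
  define q q' where "q x = \<zeta> x \<bullet> e x" and "q' x = 2 * (\<zeta> x \<bullet> e' x) - \<zeta> x \<bullet> (Q' x *v \<zeta> x)" for x
  have q: "AC_deriv a b q q'"
    unfolding q_def[abs_def] q'_def[abs_def] by (rule AC_deriv_inverse_form[OF Q_AC e Q_sym \<eta> Q\<zeta>])
  have mq: "AC_deriv a b (\<lambda>x. m x * q x) (\<lambda>x. m' x * q x + m x * q' x)"
    using AC_deriv_inner[OF m q] by simp
  have pe: "AC_deriv a b (\<lambda>x. e x \<bullet> (P1 *v e x)) (\<lambda>x. e' x \<bullet> (P1 *v e x) + e x \<bullet> (P1 *v e' x))"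
    by (rule AC_deriv_inner[OF e AC_deriv_linear[OF matrix_vector_mul_bounded_linear e]])
  obtain c where "L2_sym_form a b c (\<lambda>x. Q x + (\<epsilon> * m x) *\<^sub>R P1i)"
    using lyapunov_form[OF AC_deriv_continuous[OF m]] .
  then interpret L: L2_sym_form a b c "\<lambda>x. Q x + (\<epsilon> * m x) *\<^sub>R P1i" .
  have qi: "integrable (lebesgue_on {a..b}) q"
  proof -
    have "q absolutely_integrable_on {a..b}"
      by (rule absolutely_integrable_continuous_real[OF AC_deriv_continuous[OF q]])
    then show ?thesis by (simp only: integrable_lebesgue_on_Icc_iff)
  qed
  \<comment> \<open>A majorant whose integral is explicit: two exact densities and a multiple of the
    energy density.\<close>
  define r where "r x = 1/2 * (e' x \<bullet> (P1 *v e x) + e x \<bullet> (P1 *v e' x))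
      + \<epsilon> / 2 * (m' x * q x + m x * q' x) - \<epsilon> * \<delta> / 2 * q x" for x
  have "AE x in lebesgue_on {a..b}. f x \<bullet> ((Q x + (\<epsilon> * m x) *\<^sub>R P1i) *v z x) \<le> r x"
    using z\<zeta> f_eq rate AE_space
  proof eventually_elim
    case (elim x)
    then have x: "x \<in> {a..b}" by simp
    have q_form: "q x = \<zeta> x \<bullet> (Q x *v \<zeta> x)" by (simp add: q_def Q\<zeta>[OF x])
    have P1P1i: "(P1i *v \<zeta> x) \<bullet> (P1 *v e' x) = \<zeta> x \<bullet> e' x"
      unfolding sym_mat_adjoint[OF P1i_sym, symmetric] matrix_vector_mul_assoc P1i matrix_vector_mul_lid ..
    have "f x \<bullet> ((Q x + (\<epsilon> * m x) *\<^sub>R P1i) *v z x) = f x \<bullet> e x + \<epsilon> * m x * ((P1i *v \<zeta> x) \<bullet> f x)"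
      using elim(1) Q\<zeta>[OF x]
      by (simp add: matrix_vector_mult_add_rdistrib inner_add_right inner_commute
          flip: scaleR_matrix_vector_assoc)
    also have "f x \<bullet> e x = e x \<bullet> (P1 *v e' x) - e x \<bullet> (G0 *v e x)"
      using elim(2) skew_mat_form[OF P0_skew, of "e x"]
      by (simp add: inner_commute[of _ "e x"] inner_add_right inner_diff_right matrix_vector_mult_diff_rdistrib)
    also have "(P1i *v \<zeta> x) \<bullet> f x = \<zeta> x \<bullet> e' x + (P1i *v \<zeta> x) \<bullet> ((P0 - G0) *v e x)"
      using elim(2) P1P1i by (simp add: inner_add_right)
    finally have lhs: "f x \<bullet> ((Q x + (\<epsilon> * m x) *\<^sub>R P1i) *v z x) = e x \<bullet> (P1 *v e' x) - e x \<bullet> (G0 *v e x)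
        + \<epsilon> * m x * (\<zeta> x \<bullet> e' x + (P1i *v \<zeta> x) \<bullet> ((P0 - G0) *v e x))" .
    have "e' x \<bullet> (P1 *v e x) = e x \<bullet> (P1 *v e' x)"
      by (metis sym_mat_adjoint[OF P1_sym] inner_commute)
    then have rhs: "r x = e x \<bullet> (P1 *v e' x) + \<epsilon> / 2 * (m' x * q x + m x * q' x) - \<epsilon> * \<delta> / 2 * q x"
      by (simp add: r_def)
    have "0 \<le> e x \<bullet> (G0 *v e x)" using G0_psd by (simp add: pos_semidef_def)
    moreover have Bf: "\<zeta> x \<bullet> (B x *v \<zeta> x) = \<zeta> x \<bullet> (Q' x *v \<zeta> x) + 2 * ((P1i *v \<zeta> x) \<bullet> ((P0 - G0) *v e x))"
      using B_form[OF x, of "\<zeta> x"] Q\<zeta>[OF x] by simp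
    moreover have "\<epsilon> / 2 * (m x * (\<zeta> x \<bullet> (B x *v \<zeta> x)) + \<delta> * q x) \<le> \<epsilon> / 2 * (m' x * q x)"
      using elim(3) \<epsilon> unfolding q_form by (intro mult_left_mono) auto
    ultimately show ?case
      unfolding lhs rhs q'_def Bf by (simp add: algebra_simps)
  qed
  moreover have ri: "integrable (lebesgue_on {a..b}) r"
    unfolding r_def[abs_def]
    by (intro Bochner_Integration.integrable_diff Bochner_Integration.integrable_add integrable_mult_right
        AC_deriv_LINT(1)[OF pe a_le_b] AC_deriv_LINT(1)[OF mq a_le_b, simplified] qi)
  ultimately have "L2_form a b (\<lambda>x. Q x + (\<epsilon> * m x) *\<^sub>R P1i) f z \<le> (LINT x|lebesgue_on {a..b}. r x)"
    unfolding L2_form_def by (intro integral_mono_AE L.integrable_form L2)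
  also have "(LINT x|lebesgue_on {a..b}. r x)
      = 1/2 * (e b \<bullet> (P1 *v e b) - e a \<bullet> (P1 *v e a)) + \<epsilon> / 2 * (m b * q b - m a * q a)
        - \<epsilon> * \<delta> / 2 * (LINT x|lebesgue_on {a..b}. q x)"
    unfolding r_def[abs_def]
    using AC_deriv_LINT[OF pe a_le_b] AC_deriv_LINT[OF mq a_le_b] qi
    by (simp only: Bochner_Integration.integral_diff Bochner_Integration.integral_add
        Bochner_Integration.integrable_add integrable_mult_right integral_mult_right_zero)
  also have "(LINT x|lebesgue_on {a..b}. q x) = L2_form a b Q z z"
    unfolding L2_form_def
  proof (rule integral_cong_AE)
    show "q \<in> borel_measurable (lebesgue_on {a..b})" using qi by auto
    show "(\<lambda>x. z x \<bullet> (Q x *v z x)) \<in> borel_measurable (lebesgue_on {a..b})"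
      by (intro borel_measurable_inner L2_fun_measurable L2
          borel_measurable_bilinear[OF bilinear_matrix_vector_mult continuous_on_measurable_Icc[OF Q_cont]]) simp
    show "AE x in lebesgue_on {a..b}. q x = z x \<bullet> (Q x *v z x)"
      using z\<zeta> AE_space by eventually_elim (simp add: q_def Q\<zeta>)
  qed
  also have "1/2 * (e b \<bullet> (P1 *v e b) - e a \<bullet> (P1 *v e a)) + \<epsilon> / 2 * (m b * q b - m a * q a)
        - \<epsilon> * \<delta> / 2 * L2_form a b Q z z \<le> - (\<epsilon> * \<delta> / 2) * L2_form a b Q z z"
  proof -
    define y where "y = W1t *v e b"
    \<comment> \<open>No power flows through a: \<open>W2 *v e a = 0\<close> kills the pairing. At b
      the feedback turns the pairing into -2 y \<bullet> K y, and the multiplier term at a has a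
      favourable sign.\<close>
    have "e a \<bullet> (P1 *v e a) = - (e a \<bullet> ((transpose W2 ** W2t + transpose W2t ** W2) *v e a))"
      by (subst W2_P1) (simp only: uminus_matrix_vector_mult inner_minus_right)
    then have ea: "e a \<bullet> (P1 *v e a) = 0" by (simp add: symmetrised_product_form bca)
    have "W1 *v e b = - (K *v y)" using bcb by (simp add: y_def eq_neg_iff_add_eq_0)
    then have eb: "e b \<bullet> (P1 *v e b) = - 2 * (y \<bullet> (K *v y))"
      using symmetrised_product_form[of "e b" W1 W1t] by (simp add: W1_P1 y_def inner_commute)
    have "q b = y \<bullet> (Psi b *v y)"
      unfolding Psi_form y_def output_lift_eq[OF bcb] by (simp add: q_def \<zeta>_def inner_commute)
    then have "\<epsilon> / 2 * (m b * q b) \<le> y \<bullet> (K *v y)" using bc by simp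
    moreover have "0 \<le> q a"
      using Q_form_nonneg[of a "\<zeta> a"] Q\<zeta>[of a] a_le_b by (simp add: q_def)
    then have "0 \<le> \<epsilon> / 2 * (m a * q a)" using \<epsilon> m_nonneg[of a] a_le_b by simp
    ultimately show ?thesis unfolding ea eb by (simp add: right_diff_distrib)
  qed
  finally show ?thesis .
qed

text \<open>By \<open>small\<close> the Lyapunov form lies between 1 - r and 1 + r times that of
  \<open>Q\<close>. The upper comparison turns dissipation of the energy into decay of the Lyapunov
  form and costs the factor 1 / (1 + r) in the rate; returning to the energy gives M = (1 + r) / (1
  - r).\<close>

lemma lyapunov_decay:
  fixes m m' :: "real \<Rightarrow> real"
  assumes m: "AC_deriv a b m m'" and m_nonneg: "\<And>x. x \<in> {a..b} \<Longrightarrow> 0 \<le> m x"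
    and \<epsilon>: "0 < \<epsilon>" and \<delta>: "0 < \<delta>" and r: "0 \<le> r" "r < 1"
    and rate: "AE x in lebesgue_on {a..b}. \<forall>v.
      m x * (v \<bullet> (B x *v v)) + \<delta> * (v \<bullet> (Q x *v v)) \<le> m' x * (v \<bullet> (Q x *v v))"
    and bc: "\<And>y. \<epsilon> / 2 * (m b * (y \<bullet> (Psi b *v y))) \<le> y \<bullet> (K *v y)"
    and small: "\<And>x v. x \<in> {a..b} \<Longrightarrow> \<epsilon> * m x * \<bar>v \<bullet> (P1i *v v)\<bar> \<le> r * (v \<bullet> (Q x *v v))"
  shows "energy_decays_at_rate a b P1 P0 G0 Q W1 W1t W2 K (\<epsilon> * \<delta> / (1 + r))"
proof -
  let ?L = "\<lambda>x. Q x + (\<epsilon> * m x) *\<^sub>R P1i"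
  let ?\<alpha> = "\<epsilon> * \<delta> / (1 + r)"
  obtain c where "L2_sym_form a b c ?L"
    using lyapunov_form[OF AC_deriv_continuous[OF m]] .
  then interpret L: L2_sym_form a b c ?L .
  \<comment> \<open>With weight 0 the same lemma yields the coefficient \<open>Q\<close>
    itself.\<close>
  obtain c' where "L2_sym_form a b c' (\<lambda>x. Q x + (0 * m x) *\<^sub>R P1i)"
    using lyapunov_form[OF AC_deriv_continuous[OF m]] .
  then interpret E: L2_sym_form a b c' Q by simp
  have compare: "(1 - r) * (v \<bullet> (Q x *v v)) \<le> v \<bullet> (?L x *v v)" "v \<bullet> (?L x *v v) \<le> (1 + r) * (v \<bullet> (Q x *v v))"
    if "x \<in> {a..b}" for x v
  proof -
    have "v \<bullet> (?L x *v v) = v \<bullet> (Q x *v v) + \<epsilon> * m x * (v \<bullet> (P1i *v v))"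
      by (simp add: matrix_vector_mult_add_rdistrib inner_add_right flip: scaleR_matrix_vector_assoc)
    moreover have "\<bar>\<epsilon> * m x * (v \<bullet> (P1i *v v))\<bar> \<le> r * (v \<bullet> (Q x *v v))"
      using small[OF that, of v] m_nonneg[OF that] \<epsilon> by (simp add: abs_mult)
    ultimately show "(1 - r) * (v \<bullet> (Q x *v v)) \<le> v \<bullet> (?L x *v v)"
      "v \<bullet> (?L x *v v) \<le> (1 + r) * (v \<bullet> (Q x *v v))"
      by (simp_all add: algebra_simps abs_le_iff)
  qed
  have lower: "(1 - r) * L2_form a b Q u u \<le> L2_form a b ?L u u"
    and upper: "L2_form a b ?L u u \<le> (1 + r) * L2_form a b Q u u"
    and Qnn: "0 \<le> L2_form a b Q u u" if "L2_fun a b u" for u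
  proof -
    have "(LINT x|lebesgue_on {a..b}. (1 - r) * (u x \<bullet> (Q x *v u x))) \<le> L2_form a b ?L u u"
      unfolding L2_form_def
      using compare by (intro integral_mono integrable_mult_right E.integrable_form L.integrable_form that) auto
    then show "(1 - r) * L2_form a b Q u u \<le> L2_form a b ?L u u" by (simp add: L2_form_def)
    have "L2_form a b ?L u u \<le> (LINT x|lebesgue_on {a..b}. (1 + r) * (u x \<bullet> (Q x *v u x)))"
      unfolding L2_form_def
      using compare by (intro integral_mono integrable_mult_right E.integrable_form L.integrable_form that) auto
    then show "L2_form a b ?L u u \<le> (1 + r) * L2_form a b Q u u" by (simp add: L2_form_def)
    show "0 \<le> L2_form a b Q u u"
      unfolding L2_form_def by (rule Bochner_Integration.integral_nonneg) (auto intro: Q_form_nonneg)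
  qed
  have L2: "L2_fun a b u" if "op u f" for u f using that by (simp add: phs_operator_def)
  have dissip: "2 * L2_form a b ?L f u \<le> - ?\<alpha> * L2_form a b ?L u u" if "op u f" for u f
  proof -
    have "2 * L2_form a b ?L f u \<le> - (\<epsilon> * \<delta>) * L2_form a b Q u u"
      using dissipation[OF m m_nonneg _ rate bc that] \<epsilon> by simp
    also have "\<dots> = - ?\<alpha> * ((1 + r) * L2_form a b Q u u)" using r by simp
    also have "\<dots> \<le> - ?\<alpha> * L2_form a b ?L u u"
      using upper[OF L2[OF that]] \<epsilon> \<delta> r by (intro mult_left_mono_neg) auto
    finally show ?thesis .
  qed
  define M where "M = (1 + r) / (1 - r)"
  have "M \<ge> 1" using r by (simp add: M_def)
  moreover have "energy a b Q (z t) \<le> M * exp (- ?\<alpha> * t) * energy a b Q (z 0)"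
    if sol: "mild_solution a b op z" and t: "t \<ge> 0" for z t
  proof -
    have zL2: "L2_fun a b (z s)" if "s \<ge> 0" for s
      using sol that unfolding mild_solution_def by blast
    have "(1 - r) * L2_form a b Q (z t) (z t) \<le> L2_form a b ?L (z t) (z t)"
      by (rule lower[OF zL2[OF t]])
    also have "\<dots> \<le> exp (- ?\<alpha> * t) * L2_form a b ?L (z 0) (z 0)"
      by (rule L.mild_solution_form_decay[OF phs_operator_diff phs_operator_scaleR dissip sol t])
    also have "\<dots> \<le> exp (- ?\<alpha> * t) * ((1 + r) * L2_form a b Q (z 0) (z 0))"
      by (intro mult_left_mono upper zL2) auto
    finally have "L2_form a b Q (z t) (z t) \<le> M * exp (- ?\<alpha> * t) * L2_form a b Q (z 0) (z 0)"
      using r by (simp add: M_def field_simps)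
    then show ?thesis by (simp add: energy_def L2_form_def)
  qed
  ultimately show ?thesis unfolding energy_decays_at_rate_def by blast
qed

end

section \<open>Decay rates\<close>

lemma pos_form_bounds:
  assumes "\<And>v::real^'n. l * (norm v)\<^sup>2 \<le> f v" "\<And>v::real^'n. f v \<le> u * (norm v)\<^sup>2"
  shows "l \<le> u"
proof -
  obtain v :: "real^'n" where "norm v = 1" using norm_axis_1 by blast
  then show ?thesis using assms[of v] by simp
qed

context port_Hamiltonian
begin

lemma energy_decays_at_rate_mono:
  assumes "energy_decays_at_rate a b P1 P0 G0 Q W1 W1t W2 K \<alpha>'" "\<alpha> \<le> \<alpha>'"
  shows "energy_decays_at_rate a b P1 P0 G0 Q W1 W1t W2 K \<alpha>"
proof -
  obtain M where M: "M \<ge> 1" and decay: "\<And>z t. mild_solution a b op z \<Longrightarrow> t \<ge> 0 \<Longrightarrow>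
      energy a b Q (z t) \<le> M * exp (- \<alpha>' * t) * energy a b Q (z 0)"
    using assms(1) unfolding energy_decays_at_rate_def by blast
  have "energy a b Q (z t) \<le> M * exp (- \<alpha> * t) * energy a b Q (z 0)"
    if "mild_solution a b op z" "t \<ge> 0" for z t
  proof -
    have "0 \<le> energy a b Q (z 0)"
      unfolding energy_def
      by (intro mult_nonneg_nonneg Bochner_Integration.integral_nonneg) (auto intro: Q_form_nonneg)
    moreover have "exp (- \<alpha>' * t) \<le> exp (- \<alpha> * t)"
      using assms(2) that(2) by (simp add: mult_right_mono)
    ultimately have "M * exp (- \<alpha>' * t) * energy a b Q (z 0) \<le> M * exp (- \<alpha> * t) * energy a b Q (z 0)"
      using M by (intro mult_right_mono mult_left_mono) auto
    with decay[OF that] show ?thesis by (rule order_trans)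
  qed
  with M show ?thesis unfolding energy_decays_at_rate_def by blast
qed

text \<open>The coefficient \<open>Q'\<close> is only square integrable, so the multiplier grows with a pointwise
  bound of \<open>B\<close> instead of its supremum.\<close>

lemma exponentially_stable: "\<exists>\<alpha>>0. energy_decays_at_rate a b P1 P0 G0 Q W1 W1t W2 K \<alpha>"
proof -
  obtain \<eta> where \<eta>: "\<eta> > 0" "\<And>x v. x \<in> {a..b} \<Longrightarrow> \<eta> * (norm v)\<^sup>2 \<le> v \<bullet> (Q x *v v)"
    using Q_coercive by blast
  obtain cQ where cQ: "cQ > 0" "\<And>x. x \<in> {a..b} \<Longrightarrow> norm (Q x) \<le> cQ" using Q_bounded by blast
  \<comment> \<open>A uniform bound for the part of \<open>B\<close> free of \<open>Q'\<close>; then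
    \<open>k\<close> is integrable and dominates the form of \<open>B\<close>.\<close>
  define c0 where "c0 = 2 * (norm P1i * (norm (P0 - G0) * cQ))"
  have c0: "0 \<le> c0" using cQ(1) by (simp add: c0_def)
  define k where "k x = norm (Q' x) + c0" for x
  have k: "0 \<le> k x" for x using c0 by (simp add: k_def)
  have B_le: "v \<bullet> (B x *v v) \<le> k x * (norm v)\<^sup>2" if x: "x \<in> {a..b}" for x v
  proof -
    have "(P1i *v v) \<bullet> ((P0 - G0) *v (Q x *v v)) \<le> norm (P1i *v v) * norm ((P0 - G0) *v (Q x *v v))"
      by (rule norm_cauchy_schwarz)
    also have "\<dots> \<le> (norm P1i * norm v) * (norm (P0 - G0) * (cQ * norm v))"
    proof (intro mult_mono norm_matrix_vector_mult_le)
      have "norm ((P0 - G0) *v (Q x *v v)) \<le> norm (P0 - G0) * norm (Q x *v v)"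
        by (rule norm_matrix_vector_mult_le)
      also have "\<dots> \<le> norm (P0 - G0) * (cQ * norm v)"
        by (intro mult_left_mono order_trans[OF norm_matrix_vector_mult_le] mult_right_mono cQ(2) x) auto
      finally show "norm ((P0 - G0) *v (Q x *v v)) \<le> norm (P0 - G0) * (cQ * norm v)" .
    qed auto
    finally have "2 * ((P1i *v v) \<bullet> ((P0 - G0) *v (Q x *v v))) \<le> c0 * (norm v)\<^sup>2"
      by (simp add: c0_def power2_eq_square mult_ac)
    moreover have "v \<bullet> (Q' x *v v) \<le> norm (Q' x) * (norm v)\<^sup>2"
      using abs_matrix_form_le[of v "Q' x" v] by (simp add: power2_eq_square)
    ultimately show ?thesis unfolding B_form[OF x] by (simp add: k_def distrib_right)
  qed
  \<comment> \<open>For m' = m g, the summand \<open>k x / \<eta>\<close> compensates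
    \<open>B\<close>, and the summand 1 leaves the surplus \<delta> = 1, as m \<ge> 1.\<close>
  define g where "g x = 1 + k x / \<eta>" for x
  have "(\<lambda>x. norm (Q' x)) absolutely_integrable_on {a..b}"
    using absolutely_integrable_norm[OF AC_deriv_integrable[OF Q_AC]] by (simp add: o_def)
  then have gi: "g absolutely_integrable_on {a..b}"
    unfolding g_def[abs_def] k_def by (intro set_integral_add set_integrable_divide) auto
  define u where "u x = integral {a..x} g" for x
  have u: "AC_deriv a b u g" unfolding u_def[abs_def] by (rule AC_deriv_primitive[OF gi])
  define m where "m x = exp (u x)" for x
  have m: "AC_deriv a b m (\<lambda>x. m x * g x)"
    unfolding m_def[abs_def] by (rule AC_deriv_exp[OF u])
  have m1: "1 \<le> m x" if "x \<in> {a..b}" for x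
  proof -
    have "g absolutely_integrable_on {a..x}"
      using that by (intro absolutely_integrable_on_Icc_subset[OF gi]) auto
    then have "0 \<le> u x"
      unfolding u_def using k \<eta>(1)
      by (intro Henstock_Kurzweil_Integration.integral_nonneg) (auto simp: absolutely_integrable_on_def g_def)
    then show ?thesis by (simp add: m_def)
  qed
  have "bounded (m ` {a..b})"
    by (intro compact_imp_bounded compact_continuous_image AC_deriv_continuous[OF m] compact_Icc)
  then obtain mM where mM: "mM > 0" "\<forall>r\<in>m ` {a..b}. norm r \<le> mM" unfolding bounded_pos by blast
  have m_le: "m x \<le> mM" if "x \<in> {a..b}" for x
    using bspec[OF mM(2) imageI[OF that]] by simp
  have etaK: "0 < min_eig K" by (rule pos_def_min_eig_pos[OF K_pos])
  \<comment> \<open>The first bound serves the boundary condition, the second the smallness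
    condition with r = 1/2. Adding 1 to the norms keeps the denominators positive.\<close>
  define \<epsilon> where "\<epsilon> = min (min_eig K / (mM * (norm (Psi b) + 1))) (\<eta> / (2 * (mM * (norm P1i + 1))))"
  have n: "0 < mM * (norm (Psi b) + 1)" "0 < mM * (norm P1i + 1)"
    using mM(1) by (simp_all add: add_nonneg_pos)
  then have \<epsilon>: "0 < \<epsilon>" using etaK \<eta>(1) by (simp add: \<epsilon>_def)
  have "energy_decays_at_rate a b P1 P0 G0 Q W1 W1t W2 K (\<epsilon> * 1 / (1 + 1/2))"
  proof (rule lyapunov_decay[OF m _ \<epsilon>])
    show "0 \<le> m x" if "x \<in> {a..b}" for x using m1[OF that] by simp
    have "m x * (v \<bullet> (B x *v v)) + 1 * (v \<bullet> (Q x *v v)) \<le> m x * g x * (v \<bullet> (Q x *v v))"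
      if x: "x \<in> {a..b}" for x v
    proof -
      let ?q = "v \<bullet> (Q x *v v)"
      have "v \<bullet> (B x *v v) \<le> k x * (norm v)\<^sup>2" by (rule B_le[OF x])
      also have "\<dots> \<le> k x * (?q / \<eta>)"
        using \<eta>(2)[OF x, of v] \<eta>(1) k by (intro mult_left_mono) (simp_all add: field_simps)
      finally have "m x * (v \<bullet> (B x *v v)) \<le> m x * (k x * (?q / \<eta>))"
        using m1[OF x] by (intro mult_left_mono) auto
      moreover have "1 * ?q \<le> m x * ?q" by (intro mult_right_mono m1 x Q_form_nonneg)
      ultimately show ?thesis by (simp add: g_def algebra_simps)
    qed
    then show "AE x in lebesgue_on {a..b}. \<forall>v.
        m x * (v \<bullet> (B x *v v)) + 1 * (v \<bullet> (Q x *v v)) \<le> m x * g x * (v \<bullet> (Q x *v v))"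
      by (intro AE_I2) simp
    show "\<epsilon> / 2 * (m b * (y \<bullet> (Psi b *v y))) \<le> y \<bullet> (K *v y)" for y
    proof -
      have b: "b \<in> {a..b}" using a_le_b by simp
      have "y \<bullet> (Psi b *v y) \<le> norm (Psi b) * (norm y)\<^sup>2"
        using abs_matrix_form_le[of y "Psi b" y] by (simp add: power2_eq_square)
      also have "\<dots> \<le> (norm (Psi b) + 1) * (norm y)\<^sup>2" by (intro mult_right_mono) auto
      finally have "m b * (y \<bullet> (Psi b *v y)) \<le> m b * ((norm (Psi b) + 1) * (norm y)\<^sup>2)"
        using m1[OF b] by (intro mult_left_mono) auto
      also have "\<dots> \<le> mM * ((norm (Psi b) + 1) * (norm y)\<^sup>2)"
        by (intro mult_right_mono m_le b mult_nonneg_nonneg) auto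
      finally have "\<epsilon> / 2 * (m b * (y \<bullet> (Psi b *v y))) \<le> \<epsilon> / 2 * (mM * ((norm (Psi b) + 1) * (norm y)\<^sup>2))"
        using \<epsilon> by (intro mult_left_mono) auto
      also have "\<dots> \<le> \<epsilon> * (mM * ((norm (Psi b) + 1) * (norm y)\<^sup>2))"
        using \<epsilon> mM(1) by (intro mult_right_mono mult_nonneg_nonneg) auto
      also have "\<dots> = (\<epsilon> * (mM * (norm (Psi b) + 1))) * (norm y)\<^sup>2" by (simp add: mult_ac)
      also have "\<dots> \<le> min_eig K * (norm y)\<^sup>2"
      proof (rule mult_right_mono)
        have "\<epsilon> \<le> min_eig K / (mM * (norm (Psi b) + 1))" by (simp add: \<epsilon>_def)
        then show "\<epsilon> * (mM * (norm (Psi b) + 1)) \<le> min_eig K" using n(1) by (simp add: pos_le_divide_eq)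
      qed simp
      also have "\<dots> \<le> y \<bullet> (K *v y)" by (rule min_eig_le_form[OF pos_def_sym[OF K_pos]])
      finally show ?thesis .
    qed
    show "\<epsilon> * m x * \<bar>v \<bullet> (P1i *v v)\<bar> \<le> 1/2 * (v \<bullet> (Q x *v v))" if x: "x \<in> {a..b}" for x v
    proof -
      have "\<bar>v \<bullet> (P1i *v v)\<bar> \<le> norm P1i * (norm v)\<^sup>2"
        using abs_matrix_form_le[of v P1i v] by (simp add: power2_eq_square)
      also have "\<dots> \<le> (norm P1i + 1) * (norm v)\<^sup>2" by (intro mult_right_mono) auto
      finally have "\<epsilon> * m x * \<bar>v \<bullet> (P1i *v v)\<bar> \<le> \<epsilon> * mM * ((norm P1i + 1) * (norm v)\<^sup>2)"
        using \<epsilon> m_le[OF x] m1[OF x] mM(1) by (intro mult_mono) auto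
      also have "\<dots> = (\<epsilon> * (2 * (mM * (norm P1i + 1)))) / 2 * (norm v)\<^sup>2" by (simp add: mult_ac)
      also have "\<dots> \<le> \<eta> / 2 * (norm v)\<^sup>2"
      proof (intro mult_right_mono divide_right_mono)
        have "\<epsilon> \<le> \<eta> / (2 * (mM * (norm P1i + 1)))" by (simp add: \<epsilon>_def)
        then show "\<epsilon> * (2 * (mM * (norm P1i + 1))) \<le> \<eta>" using n(2) by (simp add: pos_le_divide_eq)
      qed auto
      also have "\<dots> \<le> 1/2 * (v \<bullet> (Q x *v v))" using \<eta>(2)[OF x, of v] by simp
      finally show ?thesis .
    qed
  qed auto
  then show ?thesis using \<epsilon> by (intro exI[of _ "\<epsilon> * 1 / (1 + 1/2)"]) simp
qed

text \<open>\<open>\<beta>\<close> is chosen so that \<beta> etaQ - muB = etaQ / (b - a), the margin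
  by which growth of the multiplier beats \<open>B\<close>. The relative size \<open>r\<close> stays
  independent of \<open>\<epsilon>\<close>, so that the two regimes can fix it differently.\<close>

lemma exponential_multiplier_decay:
  fixes C \<beta> \<epsilon> r muQ etaQ muB muPsi muP1 etaK :: real
  assumes C: "0 < C" and \<beta>: "0 \<le> \<beta>" "\<beta> = 1 / (b - a) + muB / etaQ"
    and \<epsilon>: "0 < \<epsilon>" and r: "0 \<le> r" "r < 1"
    and etaQ: "0 < etaQ" "\<And>x v. x \<in> {a..b} \<Longrightarrow> etaQ * (norm v)\<^sup>2 \<le> v \<bullet> (Q x *v v)"
    and muQ: "\<And>x v. x \<in> {a..b} \<Longrightarrow> v \<bullet> (Q x *v v) \<le> muQ * (norm v)\<^sup>2"
    and muB: "AE x in lebesgue_on {a..b}. \<forall>v. v \<bullet> (B x *v v) \<le> muB * (norm v)\<^sup>2"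
    and muPsi: "\<And>y. y \<bullet> (Psi b *v y) \<le> muPsi * (norm y)\<^sup>2"
    and muP1: "\<And>v. norm (P1i *v v) \<le> muP1 * norm v" "0 \<le> muP1"
    and etaK: "\<And>y. etaK * (norm y)\<^sup>2 \<le> y \<bullet> (K *v y)"
    and \<epsilon>0: "\<epsilon> * (C * exp (\<beta> * (b - a)) * muP1) \<le> r * etaQ"
    and \<epsilon>1: "\<epsilon> * (C * exp (\<beta> * (b - a)) * muPsi) \<le> 2 * etaK"
  shows "energy_decays_at_rate a b P1 P0 G0 Q W1 W1t W2 K
    (\<epsilon> * (C * etaQ / ((b - a) * muQ)) / (1 + r))"
proof -
  have "etaQ \<le> muQ"
    by (rule pos_form_bounds[of etaQ "\<lambda>v. v \<bullet> (Q a *v v)"]) (use etaQ muQ a_le_b in auto)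
  with etaQ(1) have muQ_pos: "0 < muQ" by simp
  define m where "m x = C * exp (\<beta> * (x - a))" for x
  \<comment> \<open>The constant C moves into the exponent, so the rule for exponentials applies to
    \<open>m\<close>.\<close>
  have "AC_deriv a b (\<lambda>x. ln C + \<beta> * (x - a)) (\<lambda>_. \<beta>)"
    unfolding AC_deriv_def by (auto simp: algebra_simps)
  from AC_deriv_exp[OF this] have m: "AC_deriv a b m (\<lambda>x. m x * \<beta>)"
    using C by (simp add: m_def[abs_def] exp_add)
  have m_ge: "C \<le> m x" and m_le: "m x \<le> m b" if "x \<in> {a..b}" for x
    using that C \<beta>(1) by (auto simp: m_def intro: mult_left_mono)
  have mb: "0 < m b" using C by (simp add: m_def)
  have ba: "0 < b - a" using a_less_b by simp
  have \<beta>_muB: "\<beta> * etaQ - muB = etaQ / (b - a)" using etaQ(1) by (simp add: \<beta>(2) distrib_right)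
  show ?thesis
  proof (rule lyapunov_decay[OF m _ \<epsilon> _ r])
    show "0 \<le> m x" if "x \<in> {a..b}" for x using m_ge[OF that] C by simp
    show "0 < C * etaQ / ((b - a) * muQ)" using C etaQ(1) ba muQ_pos by simp
    show "AE x in lebesgue_on {a..b}. \<forall>v. m x * (v \<bullet> (B x *v v))
        + C * etaQ / ((b - a) * muQ) * (v \<bullet> (Q x *v v)) \<le> m x * \<beta> * (v \<bullet> (Q x *v v))"
      using muB AE_space
    proof eventually_elim
      case (elim x)
      then have x: "x \<in> {a..b}" by simp
      have mx: "0 \<le> m x" using m_ge[OF x] C by simp
      show ?case
      proof
        fix v
        let ?q = "v \<bullet> (Q x *v v)"
        have "m x * (v \<bullet> (B x *v v)) \<le> m x * (muB * (norm v)\<^sup>2)"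
          using elim(1) mx by (intro mult_left_mono) auto
        moreover have "m x * \<beta> * (etaQ * (norm v)\<^sup>2) \<le> m x * \<beta> * ?q"
          using etaQ(2)[OF x] mx \<beta>(1) by (intro mult_left_mono) auto
        moreover have "m x * \<beta> * (etaQ * (norm v)\<^sup>2) = m x * (muB * (norm v)\<^sup>2) + m x * ((etaQ / (b - a)) * (norm v)\<^sup>2)"
          unfolding \<beta>_muB[symmetric] by (simp add: algebra_simps)
        moreover have "C * etaQ / ((b - a) * muQ) * ?q \<le> m x * ((etaQ / (b - a)) * (norm v)\<^sup>2)"
        proof -
          have "C * etaQ / ((b - a) * muQ) * ?q \<le> C * etaQ / ((b - a) * muQ) * (muQ * (norm v)\<^sup>2)"
            using muQ[OF x] C etaQ(1) ba muQ_pos by (intro mult_left_mono) auto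
          also have "\<dots> = C * ((etaQ / (b - a)) * (norm v)\<^sup>2)" using muQ_pos by simp
          also have "\<dots> \<le> m x * ((etaQ / (b - a)) * (norm v)\<^sup>2)"
            using m_ge[OF x] etaQ(1) ba by (intro mult_right_mono) auto
          finally show ?thesis .
        qed
        ultimately show "m x * (v \<bullet> (B x *v v)) + C * etaQ / ((b - a) * muQ) * ?q \<le> m x * \<beta> * ?q"
          by linarith
      qed
    qed
    show "\<epsilon> / 2 * (m b * (y \<bullet> (Psi b *v y))) \<le> y \<bullet> (K *v y)" for y
    proof -
      have "\<epsilon> / 2 * (m b * (y \<bullet> (Psi b *v y))) \<le> \<epsilon> / 2 * (m b * (muPsi * (norm y)\<^sup>2))"
        using \<epsilon> mb muPsi by (intro mult_left_mono) auto
      also have "\<dots> = (\<epsilon> * (m b * muPsi)) / 2 * (norm y)\<^sup>2" by simp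
      also have "\<dots> \<le> etaK * (norm y)\<^sup>2" using \<epsilon>1 by (intro mult_right_mono) (simp_all add: m_def)
      also have "\<dots> \<le> y \<bullet> (K *v y)" by (rule etaK)
      finally show ?thesis .
    qed
    show "\<epsilon> * m x * \<bar>v \<bullet> (P1i *v v)\<bar> \<le> r * (v \<bullet> (Q x *v v))" if x: "x \<in> {a..b}" for x v
    proof -
      have "\<bar>v \<bullet> (P1i *v v)\<bar> \<le> norm v * norm (P1i *v v)" by (rule Cauchy_Schwarz_ineq2)
      also have "\<dots> \<le> norm v * (muP1 * norm v)" by (intro mult_left_mono muP1) auto
      finally have "\<epsilon> * m x * \<bar>v \<bullet> (P1i *v v)\<bar> \<le> \<epsilon> * m b * (norm v * (muP1 * norm v))"
        using \<epsilon> m_le[OF x] m_ge[OF x] C mb by (intro mult_mono) auto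
      also have "\<dots> = (\<epsilon> * (m b * muP1)) * (norm v)\<^sup>2" by (simp add: power2_eq_square)
      also have "\<dots> \<le> r * etaQ * (norm v)\<^sup>2" using \<epsilon>0 by (intro mult_right_mono) (simp_all add: m_def)
      also have "\<dots> \<le> r * (v \<bullet> (Q x *v v))"
        using mult_left_mono[OF etaQ(2)[OF x, of v] r(1)] by (simp add: mult.assoc)
      finally show ?thesis .
    qed
  qed
qed

text \<open>Transposition exchanges the two product terms of \<open>B\<close>, signs
  included.\<close>

lemma B_sym:
  assumes "x \<in> {a..b}" "sym_mat (Q' x)"
  shows "sym_mat (B x)"
proof -
  have neg: "A ** (- R) = - (A ** R)" "(- R) ** A = - (R ** A)" for A R :: "real^'n^'n"
    by (simp_all add: matrix_matrix_mult_def vec_eq_iff sum_negf)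
  have t: "transpose (P0 + G0) = - (P0 - G0)" "transpose (P0 - G0) = - (P0 + G0)"
    using P0_skew G0_psd by (simp_all add: transpose_add transpose_diff skew_mat_def pos_semidef_def sym_mat_def)
  have "transpose (Q x) = Q x" "transpose P1i = P1i" "transpose (Q' x) = Q' x"
    using Q_sym[OF assms(1)] P1i_sym assms(2) by (simp_all add: sym_mat_def)
  then show ?thesis
    unfolding sym_mat_def B_mat_def transpose_add[of "Q' x - _"] transpose_diff[of "Q' x"] matrix_transpose_mul t
    by (simp add: neg matrix_mul_assoc del: minus_diff_eq minus_add_distrib)
qed

text \<open>The inverse of \<open>Q x\<close> is at most 1/\<eta> and strictly positive. The upper
  bound makes the supremum \<open>muPsi\<close> finite; positivity makes it a legitimate
  denominator.\<close>

lemma Psi_form_bounds: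
  assumes x: "x \<in> {a..b}" and \<eta>: "\<eta> > 0" "\<And>v. \<eta> * (norm v)\<^sup>2 \<le> v \<bullet> (Q x *v v)"
  shows "y \<bullet> (Psi x *v y) \<le> ((norm output_lift)\<^sup>2 / \<eta>) * (norm y)\<^sup>2"
    and "y \<noteq> 0 \<Longrightarrow> 0 < y \<bullet> (Psi x *v y)"
proof -
  define w \<zeta> where "w = output_lift *v y" and "\<zeta> = matrix_inv (Q x) *v w"
  have w: "Q x *v \<zeta> = w" by (simp add: \<zeta>_def Q_inv_vec(1)[OF x])
  have form: "y \<bullet> (Psi x *v y) = w \<bullet> \<zeta>" by (simp add: Psi_form w_def \<zeta>_def)
  have "norm \<zeta> \<le> norm w / \<eta>"
    using norm_le_coercive[OF \<eta>(2)[of \<zeta>]] \<eta>(1) by (simp add: w pos_le_divide_eq mult.commute)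
  then have "w \<bullet> \<zeta> \<le> norm w * (norm w / \<eta>)"
    by (intro order_trans[OF norm_cauchy_schwarz] mult_left_mono) auto
  also have "\<dots> \<le> (norm output_lift * norm y) * ((norm output_lift * norm y) / \<eta>)"
    using \<eta>(1) unfolding w_def
    by (intro mult_mono divide_right_mono norm_matrix_vector_mult_le) auto
  finally show "y \<bullet> (Psi x *v y) \<le> ((norm output_lift)\<^sup>2 / \<eta>) * (norm y)\<^sup>2"
    unfolding form by (simp add: power2_eq_square mult_ac)
  assume "y \<noteq> 0"
  then have "w \<noteq> 0" using output_lift_inj unfolding w_def by blast
  then have "\<zeta> \<noteq> 0" using w by auto
  then have "0 < \<zeta> \<bullet> (Q x *v \<zeta>)" using Q_pos[OF x] unfolding pos_def_def by blast
  then show "0 < y \<bullet> (Psi x *v y)" unfolding form w by (simp add: inner_commute)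
qed

end

text \<open>Since \<open>Q'\<close> is merely square integrable, the eigenvalues of
  \<open>B_mat\<close> may be unbounded, and \<open>bdd_above\<close> makes \<open>muB\<close> a
  genuine supremum. \<open>\<beta> \<ge> 0\<close> puts the maximum of the multiplier at b; for
  negative \<open>\<beta>\<close> it would be at a, and C / mu_m would be 1 instead of the
  exponential factor.\<close>

theorem theorem2:
  fixes a b C :: real
    and P1 P0 G0 :: "real^'n^'n"
    and Q Q' :: "real \<Rightarrow> real^'n^'n"
    and W1 W1t W2 W2t :: "real^'n^'k"
    and K :: "real^'k^'k"
    and muQ etaQ muB muPsi muP1 etaK \<beta> mu_m \<epsilon>0 \<epsilon>1 :: real
  assumes "a < b"
    and "CARD('n) = 2 * CARD('k)"
    and "sym_mat P1" and "invertible P1"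
    and "skew_mat P0"
    and "pos_semidef G0"
    and "H1_deriv a b Q Q'"
    and "\<And>x. x \<in> {a..b} \<Longrightarrow> pos_def (Q x)"
    and "rank (stack (beside 0 W2) (beside W1 0) :: real^('n + 'n)^('k + 'k)) = CARD('n)"
    and "rank (stack W1 W1t) = CARD('n)"
    and "transpose W1 ** W1t + transpose W1t ** W1 = P1"
    and "P1 = - (transpose W2 ** W2t + transpose W2t ** W2)"
    and "pos_def K"
    and "C > 0"
    and "muQ = (SUP x\<in>{a..b}. max_eig (Q x))"
    and "etaQ = (INF x\<in>{a..b}. min_eig (Q x))"
    and "muB = (SUP x\<in>{a..b}. max_eig (B_mat P1 P0 G0 Q Q' x))"
    and "muPsi = (SUP x\<in>{a..b}. max_eig (Psi_mat W1 W1t K Q x))"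
    and "muP1 = sqrt (max_eig (matrix_inv P1 ** matrix_inv P1))"
    and "etaK = min_eig K"
    and "\<beta> = 1 / (b - a) + muB / etaQ"
    and "mu_m = (SUP x\<in>{a..b}. C * exp (\<beta> * (x - a)))"
    and "\<epsilon>0 = etaQ / (mu_m * muP1)"
    and "\<epsilon>1 = 2 * etaK / (mu_m * muPsi)"
  shows "(\<exists>\<alpha>>0. energy_decays_at_rate a b P1 P0 G0 Q W1 W1t W2 K \<alpha>) \<and>
    (bdd_above ((\<lambda>x. max_eig (B_mat P1 P0 G0 Q Q' x)) ` {a..b}) \<longrightarrow> \<beta> \<ge> 0 \<longrightarrow>
      (\<forall>\<xi>. 0 < \<xi> \<and> \<xi> < 1 \<longrightarrow>
        energy_decays_at_rate a b P1 P0 G0 Q W1 W1t W2 K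
          (if \<epsilon>0 \<le> \<epsilon>1
           then \<xi> / (\<xi> + 1) * (etaQ\<^sup>2 * exp (- (1 + muB / etaQ * (b - a))) /
                  ((b - a) * muQ * muP1))
           else 2 * \<xi> * etaK * etaQ\<^sup>2 * exp (- (1 + muB / etaQ * (b - a))) /
                  ((b - a) * muQ * (muP1 * etaK + 2 * \<xi> * etaQ * muPsi)))))"
proof -
  interpret port_Hamiltonian a b P1 P0 G0 Q Q' W1 W1t W2 W2t K
    by (unfold_locales) fact+
  have "energy_decays_at_rate a b P1 P0 G0 Q W1 W1t W2 K
          (if \<epsilon>0 \<le> \<epsilon>1
           then \<xi> / (\<xi> + 1) * (etaQ\<^sup>2 * exp (- (1 + muB / etaQ * (b - a))) /
                  ((b - a) * muQ * muP1))
           else 2 * \<xi> * etaK * etaQ\<^sup>2 * exp (- (1 + muB / etaQ * (b - a))) /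
                  ((b - a) * muQ * (muP1 * etaK + 2 * \<xi> * etaQ * muPsi)))"
    if bdd: "bdd_above ((\<lambda>x. max_eig (B x)) ` {a..b})" and \<beta>: "\<beta> \<ge> 0" and \<xi>: "0 < \<xi>" "\<xi> < 1" for \<xi>
  proof -
    have ab: "a \<in> {a..b}" "b \<in> {a..b}" using a_le_b by auto
    obtain \<eta> where \<eta>: "\<eta> > 0" "\<And>x v. x \<in> {a..b} \<Longrightarrow> \<eta> * (norm v)\<^sup>2 \<le> v \<bullet> (Q x *v v)"
      using Q_coercive by blast
    obtain cQ where cQ: "cQ > 0" "\<And>x. x \<in> {a..b} \<Longrightarrow> norm (Q x) \<le> cQ" using Q_bounded by blast
    \<comment> \<open>The constants act as bounds only once the families under \<open>INF\<close>
      and \<open>SUP\<close> are known to be bounded; uniform coercivity and boundedness of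
      \<open>Q\<close> supply this.\<close>
    have min_eig_Q: "\<eta> \<le> min_eig (Q x)" if "x \<in> {a..b}" for x
      by (rule min_eig_ge[OF Q_sym[OF that] \<eta>(2)[OF that]])
    then have "bdd_below ((\<lambda>x. min_eig (Q x)) ` {a..b})" by (rule bdd_belowI2)
    then have "etaQ \<le> min_eig (Q x)" if "x \<in> {a..b}" for x
      unfolding \<open>etaQ = _\<close> by (rule cINF_lower[OF _ that])
    then have etaQ: "etaQ * (norm v)\<^sup>2 \<le> v \<bullet> (Q x *v v)" if "x \<in> {a..b}" for x v
      using min_eig_le_form[OF Q_sym[OF that], of v] that by (meson mult_right_mono order_trans zero_le_power2)
    have "\<eta> \<le> etaQ" unfolding \<open>etaQ = _\<close> using ab min_eig_Q by (intro cINF_greatest) auto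
    with \<eta>(1) have etaQ_pos: "0 < etaQ" by simp
    have "max_eig (Q x) \<le> cQ" if "x \<in> {a..b}" for x
    proof (rule max_eig_le[OF Q_sym[OF that]])
      fix v
      have "v \<bullet> (Q x *v v) \<le> norm (Q x) * (norm v)\<^sup>2"
        using abs_matrix_form_le[of v "Q x" v] by (simp add: power2_eq_square)
      also have "\<dots> \<le> cQ * (norm v)\<^sup>2" by (intro mult_right_mono cQ(2) that) simp
      finally show "v \<bullet> (Q x *v v) \<le> cQ * (norm v)\<^sup>2" .
    qed
    then have "bdd_above ((\<lambda>x. max_eig (Q x)) ` {a..b})" by (rule bdd_aboveI2)
    then have "max_eig (Q x) \<le> muQ" if "x \<in> {a..b}" for x
      unfolding \<open>muQ = _\<close> by (rule cSUP_upper[OF that])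
    then have muQ: "v \<bullet> (Q x *v v) \<le> muQ * (norm v)\<^sup>2" if "x \<in> {a..b}" for x v
      using form_le_max_eig[OF Q_sym[OF that], of v] that by (meson mult_right_mono order_trans zero_le_power2)
    have "etaQ \<le> muQ"
      by (rule pos_form_bounds[of etaQ "\<lambda>v. v \<bullet> (Q a *v v)"]) (use etaQ muQ ab in auto)
    with etaQ_pos have muQ_pos: "0 < muQ" by simp
    have Q'_sym: "AE x in lebesgue_on {a..b}. sym_mat (Q' x)"
      by (rule AE_sym_mat_AC_deriv[OF Q_AC a_le_b]) (rule Q_sym)
    have muB: "AE x in lebesgue_on {a..b}. \<forall>v. v \<bullet> (B x *v v) \<le> muB * (norm v)\<^sup>2"
      using Q'_sym AE_space
    proof eventually_elim
      case (elim x)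
      then have x: "x \<in> {a..b}" by simp
      have "max_eig (B x) \<le> muB" unfolding \<open>muB = _\<close> by (rule cSUP_upper[OF x bdd])
      then show ?case
        using form_le_max_eig[OF B_sym[OF x elim(1)]] by (meson mult_right_mono order_trans zero_le_power2)
    qed
    have "max_eig (Psi x) \<le> (norm output_lift)\<^sup>2 / \<eta>" if "x \<in> {a..b}" for x
      by (rule max_eig_le[OF Psi_sym[OF that] Psi_form_bounds(1)[OF that \<eta>(1) \<eta>(2)[OF that]]])
    then have "bdd_above ((\<lambda>x. max_eig (Psi x)) ` {a..b})" by (rule bdd_aboveI2)
    then have "max_eig (Psi b) \<le> muPsi" unfolding \<open>muPsi = _\<close> by (rule cSUP_upper[OF ab(2)])
    then have muPsi: "y \<bullet> (Psi b *v y) \<le> muPsi * (norm y)\<^sup>2" for y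
      using form_le_max_eig[OF Psi_sym[OF ab(2)], of y] by (meson mult_right_mono order_trans zero_le_power2)
    obtain y :: "real^'k" where y: "norm y = 1" using norm_axis_1 by blast
    then have "y \<noteq> 0" by auto
    from Psi_form_bounds(2)[OF ab(2) \<eta>(1) \<eta>(2)[OF ab(2)] this] muPsi[of y] y
    have muPsi_pos: "0 < muPsi" by simp
    \<comment> \<open>By symmetry the form of \<open>P1i ** P1i\<close> is the squared norm of
      \<open>P1i *v v\<close>, so \<open>muP1\<close> bounds the operator norm of
      \<open>P1i\<close>.\<close>
    have P1i2: "(norm (P1i *v v))\<^sup>2 \<le> max_eig (P1i ** P1i) * (norm v)\<^sup>2" for v
    proof -
      have "sym_mat (P1i ** P1i)" using P1i_sym by (simp add: sym_mat_def matrix_transpose_mul)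
      moreover have "v \<bullet> ((P1i ** P1i) *v v) = (norm (P1i *v v))\<^sup>2"
        unfolding matrix_vector_mul_assoc[symmetric] sym_mat_adjoint[OF P1i_sym] power2_norm_eq_inner ..
      ultimately show ?thesis using form_le_max_eig by metis
    qed
    have muP1: "norm (P1i *v v) \<le> muP1 * norm v" for v
    proof -
      have "sqrt ((norm (P1i *v v))\<^sup>2) \<le> sqrt (max_eig (P1i ** P1i) * (norm v)\<^sup>2)"
        by (intro real_sqrt_le_mono P1i2)
      then show ?thesis by (simp add: \<open>muP1 = _\<close> real_sqrt_mult)
    qed
    obtain v :: "real^'n" where v: "norm v = 1" using norm_axis_1 by blast
    have "P1 *v (P1i *v v) = v" by (simp add: matrix_vector_mul_assoc P1i)
    then have "P1i *v v \<noteq> 0" using v by auto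
    then have "0 < norm (P1i *v v)" by simp
    also have "\<dots> \<le> muP1" using muP1[of v] v by simp
    finally have muP1_pos: "0 < muP1" .
    have etaK: "etaK * (norm y)\<^sup>2 \<le> y \<bullet> (K *v y)" for y
      unfolding \<open>etaK = _\<close> by (rule min_eig_le_form[OF pos_def_sym[OF K_pos]])
    have etaK_pos: "0 < etaK" unfolding \<open>etaK = _\<close> by (rule pos_def_min_eig_pos[OF K_pos])
    have mu_m: "mu_m = C * exp (\<beta> * (b - a))"
      unfolding \<open>mu_m = _\<close>
    proof (rule cSup_eq_maximum)
      show "C * exp (\<beta> * (b - a)) \<in> (\<lambda>x. C * exp (\<beta> * (x - a))) ` {a..b}" using ab by blast
    qed (use \<open>C > 0\<close> \<beta> in \<open>auto intro!: mult_left_mono\<close>)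
    then have mu_m_pos: "0 < mu_m" using \<open>C > 0\<close> by simp
    define E where "E = exp (- (1 + muB / etaQ * (b - a)))"
    have ba: "0 < b - a" using a_less_b by simp
    have \<beta>_ba: "\<beta> * (b - a) = 1 + muB / etaQ * (b - a)"
      using ba by (simp add: \<open>\<beta> = _\<close> distrib_right)
    \<comment> \<open>Eliminates C from the rate: only C / mu_m enters, and it equals the
      exponential factor.\<close>
    have C_eq: "C = mu_m * E"
      unfolding mu_m E_def \<beta>_ba mult.assoc exp_minus_inverse by simp
    have E: "0 < E" by (simp add: E_def)
    note decay = exponential_multiplier_decay[OF \<open>C > 0\<close> \<beta> \<open>\<beta> = _\<close> _ _ _ etaQ_pos etaQ muQ muB muPsi
        muP1 less_imp_le[OF muP1_pos] etaK, folded mu_m]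
    have \<epsilon>0: "0 < \<epsilon>0" "\<epsilon>0 * (mu_m * muP1) = etaQ"
      and \<epsilon>1: "0 < \<epsilon>1" "\<epsilon>1 * (mu_m * muPsi) = 2 * etaK"
      using etaQ_pos etaK_pos mu_m_pos muP1_pos muPsi_pos
      by (simp_all add: \<open>\<epsilon>0 = _\<close> \<open>\<epsilon>1 = _\<close>)
    show ?thesis
    proof (cases "\<epsilon>0 \<le> \<epsilon>1")
      case True
      \<comment> \<open>Here the weight is \<xi> \<epsilon>0 and r = \<xi>; the smallness condition
        is an equality.\<close>
      have "\<xi> * \<epsilon>0 \<le> \<epsilon>1" using True \<xi> \<epsilon>0(1) by (smt (verit) mult_left_le_one_le)
      then have "\<xi> * \<epsilon>0 * (mu_m * muPsi) \<le> 2 * etaK"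
        unfolding \<epsilon>1(2)[symmetric] using mu_m_pos muPsi_pos by (intro mult_right_mono) auto
      moreover have "\<xi> * \<epsilon>0 * (mu_m * muP1) \<le> \<xi> * etaQ" using \<epsilon>0(2) by (simp add: mult.assoc)
      ultimately have "energy_decays_at_rate a b P1 P0 G0 Q W1 W1t W2 K
          (\<xi> * \<epsilon>0 * (C * etaQ / ((b - a) * muQ)) / (1 + \<xi>))"
        using \<xi> \<epsilon>0(1) by (intro decay) auto
      moreover have "\<xi> * \<epsilon>0 * (C * etaQ / ((b - a) * muQ)) / (1 + \<xi>)
          = \<xi> / (\<xi> + 1) * (etaQ\<^sup>2 * E / ((b - a) * muQ * muP1))"
        unfolding C_eq \<open>\<epsilon>0 = _\<close> using mu_m_pos muP1_pos ba muQ_pos \<xi>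
        by (simp add: field_simps power2_eq_square)
      ultimately show ?thesis using True by (simp add: E_def)
    next
      case False
      \<comment> \<open>With weight \<epsilon>1 the smallness condition holds with equality for this
        ratio, which is below 1 in this case.\<close>
      define r where "r = \<epsilon>1 / \<epsilon>0"
      have r: "0 \<le> r" "r < 1" using False \<epsilon>0(1) \<epsilon>1(1) by (auto simp: r_def)
      have "\<epsilon>1 * (mu_m * muP1) \<le> r * etaQ"
        unfolding \<epsilon>0(2)[symmetric] using \<epsilon>0(1) by (simp add: r_def)
      then have decays: "energy_decays_at_rate a b P1 P0 G0 Q W1 W1t W2 K
          (\<epsilon>1 * (C * etaQ / ((b - a) * muQ)) / (1 + r))"
        using \<epsilon>1 r by (intro decay) auto
      define X Y where "X = etaQ * muPsi" and "Y = etaK * muP1"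
      have XY: "0 < X" "0 < Y" using etaQ_pos muPsi_pos etaK_pos muP1_pos by (auto simp: X_def Y_def)
      have r_eq: "r = 2 * Y / X"
        unfolding r_def \<open>\<epsilon>0 = _\<close> \<open>\<epsilon>1 = _\<close> X_def Y_def
        using mu_m_pos muP1_pos muPsi_pos etaQ_pos by (simp add: field_simps)
      then have XY': "2 * Y < X" using r(2) XY by (simp add: pos_divide_less_eq)
      \<comment> \<open>The factor common to the rate reached and the stated rate; what remains is
        to compare two fractions in X and Y.\<close>
      define c where "c = 2 * etaK * etaQ\<^sup>2 * E / ((b - a) * muQ)"
      have c: "0 \<le> c" using etaK_pos etaQ_pos E ba muQ_pos by (simp add: c_def)
      have "\<epsilon>1 * (C * etaQ / ((b - a) * muQ)) / (1 + r) = c * (1 / (X + 2 * Y))"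
      proof -
        have "\<epsilon>1 * (C * etaQ / ((b - a) * muQ)) = c / X"
          unfolding C_eq \<open>\<epsilon>1 = _\<close> c_def X_def using mu_m_pos muPsi_pos etaQ_pos ba muQ_pos
          by (simp add: field_simps power2_eq_square)
        moreover have "X * (1 + r) = X + 2 * Y" using XY by (simp add: r_eq distrib_left)
        ultimately show ?thesis by (metis divide_divide_eq_left mult.right_neutral times_divide_eq_right)
      qed
      moreover have "2 * \<xi> * etaK * etaQ\<^sup>2 * E / ((b - a) * muQ * (muP1 * etaK + 2 * \<xi> * etaQ * muPsi))
          = c * (\<xi> / (Y + 2 * \<xi> * X))"
        by (simp add: c_def X_def Y_def mult_ac)
      moreover have "\<xi> / (Y + 2 * \<xi> * X) \<le> 1 / (X + 2 * Y)"
      proof -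
        have "\<xi> * (2 * Y) \<le> \<xi> * X" using XY' \<xi> by (intro mult_left_mono) auto
        then have "\<xi> * (X + 2 * Y) \<le> 1 * (Y + 2 * \<xi> * X)" using XY by (simp add: algebra_simps)
        then show ?thesis using XY \<xi> by (simp add: divide_le_eq le_divide_eq add_pos_pos mult.commute)
      qed
      ultimately have "2 * \<xi> * etaK * etaQ\<^sup>2 * E / ((b - a) * muQ * (muP1 * etaK + 2 * \<xi> * etaQ * muPsi))
          \<le> \<epsilon>1 * (C * etaQ / ((b - a) * muQ)) / (1 + r)"
        using mult_left_mono[OF _ c] by metis
      from energy_decays_at_rate_mono[OF decays this] show ?thesis using False by (simp add: E_def)
    qed
  qed
  then show ?thesis using exponentially_stable by blast
qed

end
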